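(* Let $n\ge 2$ and let $*:(\mathcal{S}^n_s)^2\to\mathcal{S}^n$ be an operation. Then $*$ is section covariant, continuous in the radial metric, rotation covariant, homogeneous of degree $1$, and associative if and only if one of the following holds: (a) $K*L=\{o\}$ for all $K,L\in\mathcal{S}^n_s$; (b) $K*L=K$ for all $K,L\in\mathcal{S}^n_s$; (c) $K*L=L$ for all $K,L\in\mathcal{S}^n_s$; (d) there is a $p$ with $-\infty\le p\le\infty$, $p\ne 0$, such that $*$ is $p$th radial addition, i.e. $K*L=K\,\widetilde{+}_p\,L$ for all $K,L\in\mathcal{S}^n_s$.
   Context: A star set in $\mathbb{R}^n$ is a compact set $L$ containing the origin $o$ such that the intersection of $L$ with every line through $o$ is a (possibly degenerate) closed line segment. $\mathcal{S}^n$ is the class of star sets in $\mathbb{R}^n$ and $\mathcal{S}^n_s$ the subclass of $o$-symmetric ones ($L=-L$). The radial function of $L\in\mathcal{S}^n$ is $\rho_L(x)=\max\{c: cx\in L\}$, $x\in\mathbb{R}^n\setminus\{o\}$. The radial metric is $\widetilde{\delta}(K,L)=\sup_{u\in S^{n-1}}|\rho_K(u)-\rho_L(u)|$. Properties of $*$ (for all $K,L,N,\dots\in\mathcal{S}^n_s$): section covariant: $(K*L)\cap S=(K\cap S)*(L\cap S)$ for every linear subspace $S$ of $\mathbb{R}^n$ of dimension $k$, $1\le k\le n-1$; continuous: $K_m\to K$, $L_m\to L$ in the radial metric imply $K_m*L_m\to K*L$ in the radial metric; rotation covariant: $\phi(K*L)=(\phi K)*(\phi L)$ for every rotation $\phi$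 of $\mathbb{R}^n$ about $o$; homogeneous of degree $1$: $(rK)*(rL)=r(K*L)$ for all $r\ge 0$; associative: $K*(L*N)=(K*L)*N$. (Rotation and section covariance force $K*L\in\mathcal{S}^n_s$, so associativity is meaningful.) $p$th radial addition: for $0<p<\infty$, $\rho_{K\widetilde{+}_pL}(x)^p=\rho_K(x)^p+\rho_L(x)^p$ for $x\neq o$. For $-\infty<p<0$ the same formula is used when $\rho_K(x)>0$ and $\rho_L(x)>0$, and $\rho_{K\widetilde{+}_pL}(x)=0$ otherwise. Also $K\,\widetilde{+}_{\infty}\,L=K\cup L$ and $K\,\widetilde{+}_{-\infty}\,L=K\cap L$. *)

theory Defs
  imports "HOL-Analysis.Analysis"
begin

definition star_set :: "(real ^ 'n) set \<Rightarrow> bool" where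
  "star_set L \<longleftrightarrow> compact L \<and> 0 \<in> L \<and>
     (\<forall>u. u \<noteq> 0 \<longrightarrow> (\<exists>a b. L \<inter> span {u} = closed_segment a b))"

definition star_sets :: "(real ^ 'n) set set" where
  "star_sets = {L. star_set L}"

definition sym_star_sets :: "(real ^ 'n) set set" where
  "sym_star_sets = {L. star_set L \<and> uminus ` L = L}"

text \<open>For a star set \<open>L\<close> and \<open>x \<noteq> 0\<close> the maximum is attained, see
  \<open>radial_function_mem\<close> and \<open>radial_function_ge\<close> below; at \<open>x = 0\<close> the value is junk and never used.\<close>

definition radial_function :: "(real ^ 'n) set \<Rightarrow> real ^ 'n \<Rightarrow> real" where
  "radial_function L x = (GREATEST c. c *\<^sub>R x \<in> L)"

definition radial_dist :: "(real ^ 'n) set \<Rightarrow> (real ^ 'n) set \<Rightarrow> real" where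
  "radial_dist K L = (SUP u\<in>sphere 0 1. \<bar>radial_function K u - radial_function L u\<bar>)"

definition radial_converges :: "(nat \<Rightarrow> (real ^ 'n) set) \<Rightarrow> (real ^ 'n) set \<Rightarrow> bool" where
  "radial_converges X K \<longleftrightarrow> (\<lambda>m. radial_dist (X m) K) \<longlonglongrightarrow> 0"

type_synonym 'n set_operation = "(real ^ 'n) set \<Rightarrow> (real ^ 'n) set \<Rightarrow> (real ^ 'n) set"

definition section_covariant :: "'n::finite set_operation \<Rightarrow> bool" where
  "section_covariant f \<longleftrightarrow>
     (\<forall>K\<in>sym_star_sets. \<forall>L\<in>sym_star_sets. \<forall>S.
        subspace S \<and> 1 \<le> dim S \<and> dim S \<le> CARD('n) - 1 \<longrightarrow>
        f K L \<inter> S = f (K \<inter> S) (L \<inter> S))"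

definition radially_continuous :: "'n::finite set_operation \<Rightarrow> bool" where
  "radially_continuous f \<longleftrightarrow>
     (\<forall>X Y K L. (\<forall>m. X m \<in> sym_star_sets) \<and> (\<forall>m. Y m \<in> sym_star_sets) \<and>
        K \<in> sym_star_sets \<and> L \<in> sym_star_sets \<and>
        radial_converges X K \<and> radial_converges Y L \<longrightarrow>
        radial_converges (\<lambda>m. f (X m) (Y m)) (f K L))"

definition rotation_covariant :: "'n::finite set_operation \<Rightarrow> bool" where
  "rotation_covariant f \<longleftrightarrow>
     (\<forall>K\<in>sym_star_sets. \<forall>L\<in>sym_star_sets. \<forall>A. rotation_matrix A \<longrightarrow>
        (*v) A ` f K L = f ((*v) A ` K) ((*v) A ` L))"

definition homogeneous :: "'n::finite set_operation \<Rightarrow> bool" where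
  "homogeneous f \<longleftrightarrow>
     (\<forall>K\<in>sym_star_sets. \<forall>L\<in>sym_star_sets. \<forall>r\<ge>0.
        f ((*\<^sub>R) r ` K) ((*\<^sub>R) r ` L) = (*\<^sub>R) r ` f K L)"

definition associative :: "'n::finite set_operation \<Rightarrow> bool" where
  "associative f \<longleftrightarrow>
     (\<forall>K\<in>sym_star_sets. \<forall>L\<in>sym_star_sets. \<forall>N\<in>sym_star_sets. f K (f L N) = f (f K L) N)"

text \<open>The case distinction is needed because \<open>0 powr p = 0\<close> also for \<open>p < 0\<close>.\<close>

definition is_radial_sum ::
    "real \<Rightarrow> (real ^ 'n) set \<Rightarrow> (real ^ 'n) set \<Rightarrow> (real ^ 'n) set \<Rightarrow> bool" where
  "is_radial_sum p K L M \<longleftrightarrow> star_set M \<and>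
     (\<forall>x. x \<noteq> 0 \<longrightarrow>
        (if p > 0 \<or> (radial_function K x > 0 \<and> radial_function L x > 0)
         then radial_function M x powr p = radial_function K x powr p + radial_function L x powr p
         else radial_function M x = 0))"

text \<open>For star sets \<open>K\<close>, \<open>L\<close> and real \<open>p \<noteq> 0\<close> the description is proper: see
  \<open>is_radial_sum_ex1\<close> below.\<close>

definition radial_sum :: "ereal \<Rightarrow> (real ^ 'n) set \<Rightarrow> (real ^ 'n) set \<Rightarrow> (real ^ 'n) set" where
  "radial_sum p K L =
     (if p = \<infinity> then K \<union> L
      else if p = -\<infinity> then K \<inter> L
      else (THE M. is_radial_sum (real_of_ereal p) K L M))"

lemma star_set_scale:
  assumes "star_set L" "x \<in> L" "0 \<le> c" "c \<le> 1"
  shows "c *\<^sub>R x \<in> L"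
proof (cases "x = 0")
  case True
  then show ?thesis using assms by (simp add: star_set_def)
next
  case False
  then obtain a b where ab: "L \<inter> span {x} = closed_segment a b"
    using assms(1) unfolding star_set_def by blast
  have "0 \<in> closed_segment a b"
    using assms(1) ab[symmetric] by (auto simp: star_set_def span_zero)
  moreover have "x \<in> closed_segment a b"
    using assms(2) ab[symmetric] by (auto intro: span_base)
  ultimately have "(1 - c) *\<^sub>R 0 + c *\<^sub>R x \<in> closed_segment a b"
    using convex_closed_segment[of a b] assms unfolding convex_alt by blast
  then show ?thesis using ab by auto
qed

lemma star_setI:
  fixes L :: "(real ^ 'n) set"
  assumes "compact L" "0 \<in> L" "\<And>x c. x \<in> L \<Longrightarrow> 0 \<le> c \<Longrightarrow> c \<le> 1 \<Longrightarrow> c *\<^sub>R x \<in> L"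
  shows "star_set L"
  unfolding star_set_def
proof (intro conjI allI impI)
  fix u :: "real ^ 'n" assume "u \<noteq> 0"
  let ?S = "L \<inter> span {u}"
  have "starlike ?S"
    unfolding starlike_def
  proof (intro bexI ballI subsetI)
    fix x y assume "x \<in> ?S" "y \<in> closed_segment 0 x"
    then show "y \<in> ?S"
      using assms(3) by (auto simp: closed_segment_def intro: span_scale)
  qed (use assms in \<open>auto simp: span_zero\<close>)
  then have "connected ?S" by (rule starlike_imp_connected)
  moreover have "compact ?S"
    using assms(1) closed_span by (rule compact_Int_closed)
  moreover have "collinear ?S"
    unfolding collinear_def
  proof (intro exI[of _ u] ballI)
    fix x y assume "x \<in> ?S" "y \<in> ?S"
    then obtain s t where "x = s *\<^sub>R u" "y = t *\<^sub>R u" by (auto simp: span_singleton)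
    then show "\<exists>c. x - y = c *\<^sub>R u" by (auto simp flip: scaleR_diff_left)
  qed
  moreover have "?S \<noteq> {}" using assms(2) span_zero by blast
  ultimately show "\<exists>a b. ?S = closed_segment a b"
    by (metis compact_convex_collinear_segment_alt)
qed (use assms in auto)

lemma radial_function_max:
  assumes "star_set L" "x \<noteq> 0"
  shows "radial_function L x *\<^sub>R x \<in> L \<and> (\<forall>c. c *\<^sub>R x \<in> L \<longrightarrow> c \<le> radial_function L x)"
proof -
  let ?C = "{c. c *\<^sub>R x \<in> L}"
  have "compact L" "0 \<in> L" using assms by (auto simp: star_set_def)
  have "closed ?C"
    using continuous_closed_vimage[of L "\<lambda>c. c *\<^sub>R x"] compact_imp_closed[OF \<open>compact L\<close>]
    by (simp add: vimage_def)
  obtain B where B: "\<And>y. y \<in> L \<Longrightarrow> norm y \<le> B"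
    using compact_imp_bounded[OF \<open>compact L\<close>] bounded_iff by blast
  have "bounded ?C"
    unfolding bounded_iff
  proof (intro exI[of _ "B / norm x"] ballI)
    fix c assume "c \<in> ?C"
    then have "\<bar>c\<bar> * norm x \<le> B" using B[of "c *\<^sub>R x"] by simp
    then show "norm c \<le> B / norm x" using assms(2) by (simp add: field_simps)
  qed
  then have "compact ?C" using \<open>closed ?C\<close> compact_eq_bounded_closed by blast
  moreover have "0 \<in> ?C" using \<open>0 \<in> L\<close> by simp
  ultimately obtain m where "m \<in> ?C" "\<forall>c\<in>?C. c \<le> m"
    using compact_attains_sup[of ?C] by blast
  then have "radial_function L x = m"
    unfolding radial_function_def by (intro Greatest_equality) auto
  then show ?thesis using \<open>m \<in> ?C\<close> \<open>\<forall>c\<in>?C. c \<le> m\<close> by auto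
qed

lemma radial_function_mem:
  "star_set L \<Longrightarrow> x \<noteq> 0 \<Longrightarrow> radial_function L x *\<^sub>R x \<in> L"
  using radial_function_max by blast

lemma radial_function_ge:
  "star_set L \<Longrightarrow> x \<noteq> 0 \<Longrightarrow> c *\<^sub>R x \<in> L \<Longrightarrow> c \<le> radial_function L x"
  using radial_function_max by blast

lemma radial_function_eqI:
  "c *\<^sub>R x \<in> L \<Longrightarrow> (\<And>d. d *\<^sub>R x \<in> L \<Longrightarrow> d \<le> c) \<Longrightarrow> radial_function L x = c"
  unfolding radial_function_def by (intro Greatest_equality) auto

lemma radial_function_nonneg: "star_set L \<Longrightarrow> x \<noteq> 0 \<Longrightarrow> radial_function L x \<ge> 0"
  by (rule radial_function_ge) (auto simp: star_set_def)

lemma star_set_mem_iff: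
  assumes "star_set L" "x \<noteq> 0"
  shows "x \<in> L \<longleftrightarrow> 1 \<le> radial_function L x"
proof
  assume "x \<in> L"
  then show "1 \<le> radial_function L x" using radial_function_ge[OF assms, of 1] by simp
next
  assume *: "1 \<le> radial_function L x"
  then have "(1 / radial_function L x) *\<^sub>R (radial_function L x *\<^sub>R x) \<in> L"
    by (intro star_set_scale radial_function_mem assms) (auto simp: field_simps)
  then show "x \<in> L" using * by simp
qed

lemma star_set_eqI:
  assumes "star_set K" "star_set L" "\<And>x. x \<noteq> 0 \<Longrightarrow> radial_function K x = radial_function L x"
  shows "K = L"
proof (rule set_eqI)
  fix x show "x \<in> K \<longleftrightarrow> x \<in> L"
    using assms star_set_mem_iff[of K x] star_set_mem_iff[of L x]
    by (cases "x = 0") (auto simp: star_set_def)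
qed

lemma is_radial_sum_unique:
  assumes "p \<noteq> 0" "is_radial_sum p K L M" "is_radial_sum p K L N"
  shows "M = N"
proof (rule star_set_eqI)
  show M: "star_set M" and N: "star_set N" using assms by (auto simp: is_radial_sum_def)
  fix x :: "real ^ 'a" assume "x \<noteq> 0"
  have *: "a = b" if "a powr p = b powr p" "a \<ge> 0" "b \<ge> 0" for a b :: real
  proof -
    have "(a powr p) powr (1 / p) = (b powr p) powr (1 / p)" using that(1) by (rule arg_cong)
    then show ?thesis using that(2,3) assms(1) by (simp add: powr_powr)
  qed
  show "radial_function M x = radial_function N x"
  proof (cases "p > 0 \<or> (radial_function K x > 0 \<and> radial_function L x > 0)")
    case True
    then have "radial_function M x powr p = radial_function N x powr p"
      using assms(2,3) \<open>x \<noteq> 0\<close> unfolding is_radial_sum_def by simp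
    then show ?thesis
      using * radial_function_nonneg M N \<open>x \<noteq> 0\<close> by blast
  next
    case False
    then have "radial_function M x = 0 \<and> radial_function N x = 0"
      using assms(2,3) \<open>x \<noteq> 0\<close> unfolding is_radial_sum_def by presburger
    then show ?thesis by simp
  qed
qed

lemma is_radial_sum_ex_pos:
  fixes K L :: "(real ^ 'n) set"
  assumes K: "star_set K" and L: "star_set L" and p: "p > 0"
  shows "\<exists>M. is_radial_sum p K L M"
proof -
  define T where "T = {(z, x). fst z powr p + snd z powr p = 1 \<and> fst z *\<^sub>R x \<in> K \<and> snd z *\<^sub>R x \<in> L}
    \<inter> (({0..1::real} \<times> {0..1::real}) \<times> (UNIV :: (real ^ 'n) set))"
  define M where "M = {x. \<exists>z\<in>{0..1} \<times> {0..1}. (z, x) \<in> T}"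
  have M_iff: "x \<in> M \<longleftrightarrow> (\<exists>a b. 0 \<le> a \<and> a \<le> 1 \<and> 0 \<le> b \<and> b \<le> 1 \<and> a powr p + b powr p = 1 \<and>
      a *\<^sub>R x \<in> K \<and> b *\<^sub>R x \<in> L)" for x
    unfolding M_def T_def by (auto simp: Bex_def)
  have cK: "closed K" "closed L" "0 \<in> K" "0 \<in> L" "compact K" "compact L"
    using K L compact_imp_closed by (auto simp: star_set_def)
  let ?D = "(({0..1::real} \<times> {0..1::real}) \<times> (UNIV :: (real ^ 'n) set))"
  have "closed ?D" by (intro closed_Times) auto
  have cont: "continuous_on ?D (\<lambda>y. fst (fst y) powr p + snd (fst y) powr p)"
    by (intro continuous_intros continuous_on_powr') (use p in auto)
  have c1: "closed (?D \<inter> (\<lambda>y. fst (fst y) powr p + snd (fst y) powr p) -` {1})"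
    using continuous_closed_preimage[OF cont \<open>closed ?D\<close>, of "{1}"] by simp
  have c2: "closed ((\<lambda>y :: (real \<times> real) \<times> (real ^ 'n). fst (fst y) *\<^sub>R snd y) -` K)"
    by (intro continuous_closed_vimage cK) (intro continuous_intros)
  have c3: "closed ((\<lambda>y :: (real \<times> real) \<times> (real ^ 'n). snd (fst y) *\<^sub>R snd y) -` L)"
    by (intro continuous_closed_vimage cK) (intro continuous_intros)
  have "T = (?D \<inter> (\<lambda>y. fst (fst y) powr p + snd (fst y) powr p) -` {1}) \<inter>
      ((\<lambda>y. fst (fst y) *\<^sub>R snd y) -` K \<inter> (\<lambda>y. snd (fst y) *\<^sub>R snd y) -` L)"
    by (auto simp: T_def)
  then have "closed T" using closed_Int[OF c1 closed_Int[OF c2 c3]] by simp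
  then have "closed M"
    using closed_compact_projection[of "{0..1::real} \<times> {0..1::real}" T]
    by (auto simp: M_def Bex_def compact_Times)
  obtain B1 B2 where B: "\<And>y. y \<in> K \<Longrightarrow> norm y \<le> B1" "\<And>y. y \<in> L \<Longrightarrow> norm y \<le> B2"
    using cK compact_imp_bounded bounded_iff by metis
  have B0: "B1 \<ge> 0" "B2 \<ge> 0" using B cK by force+
  define e where "e = (1 / 2) powr (1 / p)"
  have e: "e > 0" "e powr p = 1 / 2" using p by (auto simp: e_def powr_powr)
  have "bounded M"
    unfolding bounded_iff
  proof (intro exI[of _ "(B1 + B2) / e"] ballI)
    fix x assume "x \<in> M"
    then obtain a b where ab: "0 \<le> a" "0 \<le> b" "a powr p + b powr p = 1" "a *\<^sub>R x \<in> K" "b *\<^sub>R x \<in> L"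
      using M_iff by blast
    have "a \<ge> e \<or> b \<ge> e"
    proof (rule ccontr)
      assume "\<not> ?thesis"
      then have "a powr p < e powr p" "b powr p < e powr p"
        using ab p by (auto intro!: powr_less_mono2)
      then show False using ab e by simp
    qed
    moreover have "a * norm x \<le> B1" "b * norm x \<le> B2"
      using B(1)[OF ab(4)] B(2)[OF ab(5)] ab by auto
    ultimately have "e * norm x \<le> B1 + B2"
      using B0 by (smt (verit) mult_right_mono norm_ge_zero)
    then show "norm x \<le> (B1 + B2) / e" using e by (simp add: field_simps)
  qed
  then have "compact M" using \<open>closed M\<close> compact_eq_bounded_closed by blast
  have M: "star_set M"
  proof (rule star_setI[OF \<open>compact M\<close>])
    show "0 \<in> M" unfolding M_iff using cK p by (intro exI[of _ 0] exI[of _ 1]) auto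
    fix x c assume x: "x \<in> M" and c: "0 \<le> c" "c \<le> (1::real)"
    from x obtain a b where ab: "0 \<le> a" "a \<le> 1" "0 \<le> b" "b \<le> 1" "a powr p + b powr p = 1"
      "a *\<^sub>R x \<in> K" "b *\<^sub>R x \<in> L"
      using M_iff by blast
    have "a *\<^sub>R (c *\<^sub>R x) \<in> K" "b *\<^sub>R (c *\<^sub>R x) \<in> L"
      using star_set_scale[OF K ab(6) c] star_set_scale[OF L ab(7) c] by (simp_all add: mult.commute)
    then show "c *\<^sub>R x \<in> M" using ab M_iff by blast
  qed
  have "radial_function M x powr p = radial_function K x powr p + radial_function L x powr p"
    if x: "x \<noteq> 0" for x
  proof -
    define s where "s = radial_function K x"
    define t where "t = radial_function L x"
    define H where "H = (s powr p + t powr p) powr (1 / p)"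
    have s: "s \<ge> 0" "s *\<^sub>R x \<in> K" "\<And>d. d *\<^sub>R x \<in> K \<Longrightarrow> d \<le> s"
      using radial_function_nonneg[OF K x] radial_function_mem[OF K x] radial_function_ge[OF K x]
      by (auto simp: s_def)
    have t: "t \<ge> 0" "t *\<^sub>R x \<in> L" "\<And>d. d *\<^sub>R x \<in> L \<Longrightarrow> d \<le> t"
      using radial_function_nonneg[OF L x] radial_function_mem[OF L x] radial_function_ge[OF L x]
      by (auto simp: t_def)
    have H: "H \<ge> 0" "H powr p = s powr p + t powr p" using p by (auto simp: H_def powr_powr)
    have "radial_function M x = H"
    proof (rule radial_function_eqI)
      show "H *\<^sub>R x \<in> M"
      proof (cases "H = 0")
        case True
        then show ?thesis using M by (auto simp: star_set_def)
      next
        case False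
        have eq: "(s / H) powr p + (t / H) powr p = 1"
        proof -
          have "(s / H) powr p + (t / H) powr p = H powr p / H powr p"
            unfolding H(2) add_divide_distrib using H s t by (simp add: powr_divide)
          then show ?thesis using False by simp
        qed
        have le: "y \<le> 1" if "y powr p \<le> 1" "y \<ge> 0" for y :: real
          using that p powr_less_mono2[of p 1 y] by (metis not_le powr_one_eq_one zero_le_one)
        have "(s / H) powr p \<le> 1" "(t / H) powr p \<le> 1"
          using eq powr_ge_zero[of "s / H" p] powr_ge_zero[of "t / H" p] by linarith+
        moreover have "s / H \<ge> 0" "t / H \<ge> 0" using s t H by auto
        ultimately have "s / H \<le> 1" "t / H \<le> 1" using le by blast+
        then show ?thesis unfolding M_iff using False H s t eq
          by (intro exI[of _ "s / H"] exI[of _ "t / H"]) auto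
      qed
      fix d assume "d *\<^sub>R x \<in> M"
      then obtain a b where ab: "0 \<le> a" "0 \<le> b" "a powr p + b powr p = 1"
        "(a * d) *\<^sub>R x \<in> K" "(b * d) *\<^sub>R x \<in> L"
        unfolding M_iff by auto
      show "d \<le> H"
      proof (rule ccontr)
        assume "\<not> d \<le> H"
        then have d: "d > H" "d > 0" using H(1) by auto
        have "(a * d) powr p \<le> s powr p" "(b * d) powr p \<le> t powr p"
          using ab d p s(3)[OF ab(4)] t(3)[OF ab(5)] by (auto intro!: powr_mono2)
        then have "(a powr p + b powr p) * d powr p \<le> H powr p"
          unfolding distrib_right using H ab(1,2) d by (simp add: powr_mult)
        moreover have "H powr p < d powr p" using d H p by (intro powr_less_mono2) auto
        ultimately show False using ab by simp
      qed
    qed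
    then show ?thesis using H by (simp add: s_def t_def)
  qed
  then show ?thesis using M p unfolding is_radial_sum_def by auto
qed

lemma is_radial_sum_ex_neg:
  fixes K L :: "(real ^ 'n) set"
  assumes K: "star_set K" and L: "star_set L" and p: "p < 0"
  shows "\<exists>M. is_radial_sum p K L M"
proof -
  define q where "q = - p"
  have q: "q > 0" "p = - q" using p by (auto simp: q_def)
  let ?D = "(({0..1::real} \<times> {0..1::real}) \<times> (K \<times> L))"
  define T where "T = {w\<in>?D. fst (fst w) powr q + snd (fst w) powr q \<le> 1} \<inter>
    {w\<in>?D. fst (fst w) *\<^sub>R fst (snd w) = snd (fst w) *\<^sub>R snd (snd w)}"
  define M where "M = (\<lambda>w. fst (fst w) *\<^sub>R fst (snd w)) ` T"
  have M_iff: "x \<in> M \<longleftrightarrow> (\<exists>a b y z. 0 \<le> a \<and> a \<le> 1 \<and> 0 \<le> b \<and> b \<le> 1 \<and> a powr q + b powr q \<le> 1 \<and>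
      y \<in> K \<and> z \<in> L \<and> x = a *\<^sub>R y \<and> x = b *\<^sub>R z)" (is "_ \<longleftrightarrow> ?R") for x
  proof
    assume "x \<in> M" then show ?R by (fastforce simp: M_def T_def)
  next
    assume ?R
    then obtain a b y z where "0 \<le> a \<and> a \<le> 1 \<and> 0 \<le> b \<and> b \<le> 1 \<and> a powr q + b powr q \<le> 1 \<and>
      y \<in> K \<and> z \<in> L \<and> x = a *\<^sub>R y \<and> x = b *\<^sub>R z" by blast
    then have "((a, b), (y, z)) \<in> T" "x = (\<lambda>w. fst (fst w) *\<^sub>R fst (snd w)) ((a, b), (y, z))"
      by (auto simp: T_def)
    then show "x \<in> M" unfolding M_def by blast
  qed
  have cK: "closed K" "closed L" "0 \<in> K" "0 \<in> L" "compact K" "compact L"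
    using K L compact_imp_closed by (auto simp: star_set_def)
  have cD: "compact ?D" by (intro compact_Times cK) auto
  have c1: "continuous_on ?D (\<lambda>w. fst (fst w) powr q + snd (fst w) powr q)"
    by (intro continuous_intros continuous_on_powr') (use q in auto)
  have c2: "continuous_on ?D (\<lambda>w. fst (fst w) *\<^sub>R fst (snd w) - snd (fst w) *\<^sub>R snd (snd w))"
    by (intro continuous_intros)
  have "closed (?D \<inter> (\<lambda>w. fst (fst w) powr q + snd (fst w) powr q) -` {..1})"
    "closed (?D \<inter> (\<lambda>w. fst (fst w) *\<^sub>R fst (snd w) - snd (fst w) *\<^sub>R snd (snd w)) -` {0})"
    using continuous_closed_preimage[OF c1 compact_imp_closed[OF cD]]
      continuous_closed_preimage[OF c2 compact_imp_closed[OF cD]] by auto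
  moreover have "T = ?D \<inter> ((?D \<inter> (\<lambda>w. fst (fst w) powr q + snd (fst w) powr q) -` {..1}) \<inter>
    (?D \<inter> (\<lambda>w. fst (fst w) *\<^sub>R fst (snd w) - snd (fst w) *\<^sub>R snd (snd w)) -` {0}))"
    by (auto simp: T_def)
  ultimately have "compact T" using compact_Int_closed[OF cD closed_Int] by simp
  then have "compact M"
    unfolding M_def by (intro compact_continuous_image continuous_intros)
  have M: "star_set M"
  proof (rule star_setI[OF \<open>compact M\<close>])
    show "0 \<in> M" unfolding M_iff using cK q by (intro exI[of _ 0]) auto
    fix x c assume x: "x \<in> M" and c: "0 \<le> c" "c \<le> (1::real)"
    from x obtain a b y z where ab: "0 \<le> a" "a \<le> 1" "0 \<le> b" "b \<le> 1" "a powr q + b powr q \<le> 1"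
      "y \<in> K" "z \<in> L" "x = a *\<^sub>R y" "x = b *\<^sub>R z"
      using M_iff by blast
    have "c *\<^sub>R y \<in> K" "c *\<^sub>R z \<in> L"
      using star_set_scale[OF K ab(6) c] star_set_scale[OF L ab(7) c] by auto
    moreover have "c *\<^sub>R x = a *\<^sub>R (c *\<^sub>R y)" "c *\<^sub>R x = b *\<^sub>R (c *\<^sub>R z)"
      using ab by (metis scaleR_left_commute)+
    ultimately show "c *\<^sub>R x \<in> M" using ab(1-5) M_iff by blast
  qed
  have "if radial_function K x > 0 \<and> radial_function L x > 0
    then radial_function M x powr p = radial_function K x powr p + radial_function L x powr p
    else radial_function M x = 0"
    if x: "x \<noteq> 0" for x
  proof -
    define s where "s = radial_function K x"
    define t where "t = radial_function L x"
    have s: "s \<ge> 0" "s *\<^sub>R x \<in> K" "\<And>d. d *\<^sub>R x \<in> K \<Longrightarrow> d \<le> s"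
      using radial_function_nonneg[OF K x] radial_function_mem[OF K x] radial_function_ge[OF K x]
      by (auto simp: s_def)
    have t: "t \<ge> 0" "t *\<^sub>R x \<in> L" "\<And>d. d *\<^sub>R x \<in> L \<Longrightarrow> d \<le> t"
      using radial_function_nonneg[OF L x] radial_function_mem[OF L x] radial_function_ge[OF L x]
      by (auto simp: t_def)
    have pos: "\<exists>a b. 0 < a \<and> 0 < b \<and> a powr q + b powr q \<le> 1 \<and> d / a \<le> s \<and> d / b \<le> t"
      if d: "d *\<^sub>R x \<in> M" "d > 0" for d
    proof -
      obtain a b y z where ab: "0 \<le> a" "0 \<le> b" "a powr q + b powr q \<le> 1"
        "y \<in> K" "z \<in> L" "d *\<^sub>R x = a *\<^sub>R y" "d *\<^sub>R x = b *\<^sub>R z"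
        using d(1) M_iff by blast
      have "d *\<^sub>R x \<noteq> 0" using d x by simp
      then have ab0: "a > 0" "b > 0" using ab by (auto simp: less_le)
      have "(1 / a) *\<^sub>R (d *\<^sub>R x) = y" using ab(6) ab0 by simp
      then have "d / a \<le> s" using s(3)[of "d / a"] ab(4) by simp
      have "(1 / b) *\<^sub>R (d *\<^sub>R x) = z" using ab(7) ab0 by simp
      then have "d / b \<le> t" using t(3)[of "d / b"] ab(5) by simp
      with \<open>d / a \<le> s\<close> show ?thesis using ab ab0 by blast
    qed
    show ?thesis
    proof (cases "s > 0 \<and> t > 0")
      case False
      have "radial_function M x = 0"
      proof (rule radial_function_eqI)
        show "0 *\<^sub>R x \<in> M" using M by (auto simp: star_set_def)
        fix d assume d: "d *\<^sub>R x \<in> M"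
        show "d \<le> 0"
        proof (rule ccontr)
          assume "\<not> d \<le> 0"
          then obtain a b where "0 < a" "0 < b" "d / a \<le> s" "d / b \<le> t" "d > 0"
            using pos[OF d] by auto
          then show False using False by (smt (verit) divide_pos_pos)
        qed
      qed
      then show ?thesis using False by (auto simp: s_def t_def)
    next
      case True
      define H where "H = (s powr p + t powr p) powr (1 / p)"
      have "s powr p + t powr p > 0" using True by (simp add: add_pos_pos)
      then have H: "H > 0" "H powr p = s powr p + t powr p"
        using p by (auto simp: H_def powr_powr)
      have key: "(d / s) powr q + (d / t) powr q = d powr q / H powr q" if "d > 0" for d
      proof -
        have "(d / s) powr q + (d / t) powr q = d powr q * (s powr p + t powr p)"
          using that True by (simp add: powr_divide q powr_minus field_simps)
        also have "\<dots> = d powr q * H powr p" using H by simp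
        also have "\<dots> = d powr q / H powr q" by (simp add: q powr_minus field_simps)
        finally show ?thesis .
      qed
      have "radial_function M x = H"
      proof (rule radial_function_eqI)
        have eq: "(H / s) powr q + (H / t) powr q = 1" using key[OF H(1)] H(1) by simp
        have le: "y \<le> 1" if "y powr q \<le> 1" "y \<ge> 0" for y :: real
          using that q powr_less_mono2[of q 1 y] by (metis not_le powr_one_eq_one zero_le_one)
        have "H / s \<le> 1" "H / t \<le> 1"
          using eq le[of "H / s"] le[of "H / t"] True H(1)
            powr_ge_zero[of "H / s" q] powr_ge_zero[of "H / t" q]
          by (auto simp: less_imp_le)
        then show "H *\<^sub>R x \<in> M" unfolding M_iff using True H(1) s t eq
          by (intro exI[of _ "H / s"] exI[of _ "H / t"] exI[of _ "s *\<^sub>R x"] exI[of _ "t *\<^sub>R x"]) auto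
        fix d assume d: "d *\<^sub>R x \<in> M"
        show "d \<le> H"
        proof (rule ccontr)
          assume "\<not> d \<le> H"
          then have dH: "d > H" "d > 0" using H(1) by auto
          then obtain a b where ab: "0 < a" "0 < b" "a powr q + b powr q \<le> 1" "d / a \<le> s" "d / b \<le> t"
            using pos[OF d] by auto
          have "d / s \<le> a" "d / t \<le> b" using ab True by (auto simp: field_simps)
          then have "(d / s) powr q \<le> a powr q" "(d / t) powr q \<le> b powr q"
            using dH True q by (auto intro!: powr_mono2)
          then have "d powr q / H powr q \<le> 1" using key[OF dH(2)] ab by simp
          moreover have "H powr q < d powr q" using dH H q by (intro powr_less_mono2) auto
          ultimately show False using H by (simp add: field_simps)
        qed
      qed
      then show ?thesis using H True by (simp add: s_def t_def)
    qed
  qed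
  then show ?thesis using M p unfolding is_radial_sum_def by auto
qed

lemma is_radial_sum_ex1:
  assumes "star_set K" "star_set L" "p \<noteq> 0"
  shows "\<exists>!M. is_radial_sum p K L M"
  using assms is_radial_sum_ex_pos[of K L p] is_radial_sum_ex_neg[of K L p] is_radial_sum_unique
  by (metis linorder_neqE_linordered_idom)

end

theory Submission
  imports Defs
begin

text \<open>Section covariance reduces \<open>f\<close> to symmetric segments on a line, and rotation covariance makes the
  line irrelevant, so \<open>\<rho>(f K L) = g (\<rho> K) (\<rho> L)\<close> for a continuous, associative, \<open>1\<close>-homogeneous
  \<open>g\<close> on \<open>[0, \<infinity>)\<^sup>2\<close>; conversely each such \<open>g\<close> induces an operation with the five properties.
  Such a \<open>g\<close> is classified by \<open>c = g 1 1\<close>. If \<open>c = 1\<close>, then the range of \<open>g 1\<close> is its fixed point set,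
  an interval closed under multiplication, and likewise for the other argument; this leaves the
  projections, \<open>max\<close> and \<open>min\<close>. If \<open>c = 0\<close>, then \<open>g = 0\<close>. Otherwise the \<open>n\<close>-fold products of \<open>1\<close>
  form a monotone completely multiplicative sequence, hence equal \<open>n\<^sup>q\<close> with \<open>q \<noteq> 0\<close>, and homogeneity
  and continuity turn \<open>m\<^sup>q\<close> times \<open>n\<^sup>q\<close> equals \<open>(m + n)\<^sup>q\<close> into the \<open>1/q\<close>-th power sum.\<close>

section \<open>Homogeneous semigroups on the half-line\<close>

text \<open>The powers of \<open>t\<close> lie in \<open>F\<close> and are unbounded, and a
  connected set of reals contains everything between two of its points.\<close>

lemma connected_mult_closed_atLeast:
  fixes F :: "real set"
  assumes "connected F" "1 \<in> F" "\<And>x y. x \<in> F \<Longrightarrow> y \<in> F \<Longrightarrow> x * y \<in> F" "t \<in> F" "1 < t" "1 \<le> x"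
  shows "x \<in> F"
proof -
  have pow: "t ^ n \<in> F" for n using assms by (induction n) auto
  obtain n where "x < t ^ n" using real_arch_pow[OF \<open>1 < t\<close>] by blast
  then show ?thesis using connectedD_interval[OF assms(1,2) pow[of n]] assms by simp
qed

text \<open>Now the powers of \<open>t\<close> tend to 0, so \<open>x\<close> lies between one of
  them and 1.\<close>

lemma connected_mult_closed_atMost:
  fixes F :: "real set"
  assumes "connected F" "1 \<in> F" "\<And>x y. x \<in> F \<Longrightarrow> y \<in> F \<Longrightarrow> x * y \<in> F" "t \<in> F"
    "0 \<le> t" "t < 1" "0 < x" "x \<le> 1"
  shows "x \<in> F"
proof -
  have pow: "t ^ n \<in> F" for n using assms by (induction n) auto
  obtain n where "t ^ n < x" using real_arch_pow_inv[OF \<open>0 < x\<close> \<open>t < 1\<close>] by blast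
  then show ?thesis using connectedD_interval[OF assms(1) pow[of n] assms(2)] assms by simp
qed

text \<open>The type is all of the reals, so each axiom is relativized to the half-line; nothing is
  known about negative arguments.\<close>

locale homogeneous_semigroup =
  fixes m :: "real \<Rightarrow> real \<Rightarrow> real" (infixl "\<star>" 70)
  assumes nonneg: "0 \<le> s \<Longrightarrow> 0 \<le> t \<Longrightarrow> 0 \<le> s \<star> t"
    and cont: "continuous_on ({0..} \<times> {0..}) (\<lambda>z. fst z \<star> snd z)"
    and homog: "0 \<le> r \<Longrightarrow> 0 \<le> s \<Longrightarrow> 0 \<le> t \<Longrightarrow> (r * s) \<star> (r * t) = r * (s \<star> t)"
    and assoc: "0 \<le> r \<Longrightarrow> 0 \<le> s \<Longrightarrow> 0 \<le> t \<Longrightarrow> r \<star> (s \<star> t) = (r \<star> s) \<star> t"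
begin

text \<open>The axioms are symmetric in the two arguments, so each result about
  \<open>1 \<star> t\<close> has a mirror image for \<open>t \<star> 1\<close>.\<close>

lemma opposite: "homogeneous_semigroup (\<lambda>s t. t \<star> s)"
proof
  have "continuous_on ({0..} \<times> {0..}) ((\<lambda>z. fst z \<star> snd z) \<circ> (\<lambda>z. (snd z, fst z)))"
    by (intro continuous_on_compose continuous_intros continuous_on_subset[OF cont]) auto
  then show "continuous_on ({0..} \<times> {0..}) (\<lambda>z. snd z \<star> fst z)" by (simp add: o_def)
qed (auto simp: nonneg homog assoc)

lemma continuous_on_op:
  assumes "continuous_on S g" "continuous_on S h" "\<And>x. x \<in> S \<Longrightarrow> 0 \<le> g x" "\<And>x. x \<in> S \<Longrightarrow> 0 \<le> h x"
  shows "continuous_on S (\<lambda>x. g x \<star> h x)"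
  using continuous_on_compose2[OF cont, of S "\<lambda>x. (g x, h x)"] assms
  by (auto intro!: continuous_intros)

lemma eq_slice:
  assumes "0 < s" "0 \<le> t"
  shows "s \<star> t = s * (1 \<star> (t / s))"
  using homog[of s 1 "t / s"] assms by simp

lemma eq_slice':
  assumes "0 \<le> s" "0 < t"
  shows "s \<star> t = t * ((s / t) \<star> 1)"
  using homog[of t "s / t" 1] assms by simp

lemma zero_zero [simp]: "0 \<star> 0 = 0"
  using homog[of 0 0 0] by simp

lemma op_zero: "0 \<le> s \<Longrightarrow> s \<star> 0 = s * (1 \<star> 0)"
  using homog[of s 1 0] by simp

lemma zero_op: "0 \<le> s \<Longrightarrow> 0 \<star> s = s * (0 \<star> 1)"
  using homog[of s 0 1] by simp

lemma diagonal: "0 \<le> s \<Longrightarrow> s \<star> s = s * (1 \<star> 1)"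
  using homog[of s 1 1] by simp

text \<open>With \<open>a = 1 \<star> 0\<close>, associativity gives \<open>a \<star> 0 = a\<close>
  and homogeneity gives \<open>a \<star> 0 = a * a\<close>.\<close>

lemma one_zero_cases: "1 \<star> 0 = 0 \<or> 1 \<star> 0 = 1"
proof -
  have "(1 \<star> 0) \<star> 0 = 1 \<star> 0" using assoc[of 1 0 0] by simp
  then show ?thesis using op_zero[of "1 \<star> 0"] nonneg[of 1 0] by simp
qed

lemma zero_one_cases: "0 \<star> 1 = 0 \<or> 0 \<star> 1 = 1"
  using homogeneous_semigroup.one_zero_cases[OF opposite] by simp

text \<open>The two bracketings of the product of 1, 0, 1 agree; when the axes differ, one of them
  is \<open>1 \<star> 1\<close> and the other is 1.\<close>

lemma one_one_if_axes_differ: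
  assumes "1 \<star> 0 \<noteq> 0 \<star> 1"
  shows "1 \<star> 1 = 1"
  using assms one_zero_cases zero_one_cases assoc[of 1 0 1] by auto

text \<open>Both sides are continuous, and adding one positive null sequence to both coordinates
  approaches \<open>(s, t)\<close> from the open quadrant.\<close>

lemma eqI_pos:
  assumes "continuous_on ({0..} \<times> {0..}) (\<lambda>z. g (fst z) (snd z))"
    and "\<And>s t. 0 < s \<Longrightarrow> 0 < t \<Longrightarrow> s \<star> t = g s t" and "0 \<le> s" "0 \<le> t"
  shows "s \<star> t = g s t"
proof -
  let ?z = "\<lambda>n. (s + inverse (real (Suc n)), t + inverse (real (Suc n)))"
  have lim: "?z \<longlonglongrightarrow> (s, t)"
    using tendsto_add[OF tendsto_const[of s] LIMSEQ_inverse_real_of_nat]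
      tendsto_add[OF tendsto_const[of t] LIMSEQ_inverse_real_of_nat]
    by (auto intro!: tendsto_Pair)
  have z: "?z n \<in> {0..} \<times> {0..}" for n using assms(3,4) by (auto intro: add_nonneg_nonneg)
  have "(\<lambda>n. fst (?z n) \<star> snd (?z n)) \<longlonglongrightarrow> fst (s, t) \<star> snd (s, t)"
    by (rule continuous_on_tendsto_compose[OF cont lim]) (use z assms in auto)
  moreover have "(\<lambda>n. g (fst (?z n)) (snd (?z n))) \<longlonglongrightarrow> g (fst (s, t)) (snd (s, t))"
    by (rule continuous_on_tendsto_compose[OF assms(1) lim]) (use z assms in auto)
  moreover have "fst (?z n) \<star> snd (?z n) = g (fst (?z n)) (snd (?z n))" for n
    using assms by (auto intro!: assms(2) add_nonneg_pos)
  ultimately show ?thesis using LIMSEQ_unique by auto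
qed

subsection \<open>Idempotent operations\<close>

text \<open>The range \<open>F\<close> of the slice is an interval of fixed points that contains 1
  and is closed under multiplication. A single element below 1 therefore puts all of (0, 1] into
  \<open>F\<close>, and a single element above 1 puts in everything from 1 upwards.\<close>

lemma idempotent_slice:
  assumes "1 \<star> 1 = 1"
  shows "(\<forall>t. 0 < t \<and> t \<le> 1 \<longrightarrow> 1 \<star> t = t) \<or> (\<forall>t\<ge>0. 1 \<le> 1 \<star> t)" (is ?A)
    and "(\<forall>t\<ge>1. 1 \<star> t = t) \<or> (\<forall>t\<ge>0. 1 \<star> t \<le> 1)" (is ?B)
proof -
  define F where "F = (\<lambda>t. 1 \<star> t) ` {0..}"
  have fixF: "1 \<star> t = t" if "t \<in> F" for t
    using that assoc[of 1 1] assms by (auto simp: F_def)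
  have nn: "0 \<le> t" if "t \<in> F" for t using that nonneg by (auto simp: F_def)
  have F: "t \<in> F" if "0 \<le> t" "1 \<star> t = t" for t unfolding F_def using that by force
  have "connected F"
    unfolding F_def by (intro connected_continuous_image continuous_on_op continuous_intros) auto
  moreover have "1 \<in> F" using F assms by simp
  \<comment> \<open>Homogeneity gives \<open>x \<star> (x * y) = x * (1 \<star> y) = x * y\<close>;
    associativity then lets \<open>x\<close> absorb a further factor 1 on the left.\<close>
  moreover have "x * y \<in> F" if "x \<in> F" "y \<in> F" for x y
  proof -
    have "x \<star> (x * y) = x * y" using homog[of x 1 y] fixF[OF that(2)] nn[OF that(1)] nn[OF that(2)] by simp
    then have "1 \<star> (x * y) = x * y"
      using assoc[of 1 x "x * y"] fixF[OF that(1)] nn[OF that(1)] nn[OF that(2)] by simp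
    then show ?thesis using F nn that by simp
  qed
  ultimately have up: "t \<in> F \<Longrightarrow> 1 < t \<Longrightarrow> 1 \<le> x \<Longrightarrow> x \<in> F"
    and down: "t \<in> F \<Longrightarrow> t < 1 \<Longrightarrow> 0 < x \<Longrightarrow> x \<le> 1 \<Longrightarrow> x \<in> F" for t x
    using connected_mult_closed_atLeast[of F t x] connected_mult_closed_atMost[of F t x] nn[of t]
    by blast+
  have img: "1 \<star> t \<in> F" if "0 \<le> t" for t using that by (auto simp: F_def)
  show ?A
  proof (cases "\<exists>t\<in>F. t < 1")
    case True
    then show ?thesis using down fixF by blast
  next
    case False
    then show ?thesis using img by (auto simp: not_less)
  qed
  show ?B
  proof (cases "\<exists>t\<in>F. 1 < t")
    case True
    then show ?thesis using up fixF by blast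
  next
    case False
    then show ?thesis using img by (auto simp: not_less)
  qed
qed

lemma idempotent_cases:
  assumes "1 \<star> 1 = 1"
  shows "(\<forall>s\<ge>0. \<forall>t\<ge>0. s \<star> t = s) \<or> (\<forall>s\<ge>0. \<forall>t\<ge>0. s \<star> t = t) \<or>
    (\<forall>s\<ge>0. \<forall>t\<ge>0. s \<star> t = max s t) \<or> (\<forall>s\<ge>0. \<forall>t\<ge>0. s \<star> t = min s t)"
proof -
  interpret op: homogeneous_semigroup "\<lambda>s t. t \<star> s" by (rule opposite)
  have r: "1 \<star> t = t * ((1 / t) \<star> 1)" if "0 < t" for t using eq_slice'[of 1 t] that by simp
  \<comment> \<open>\<open>A'\<close> and \<open>B'\<close> are the two dichotomies for the opposite
    operation, carried back to the slice \<open>1 \<star> t\<close> by the inversion of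
    \<open>t\<close> in \<open>r\<close>.\<close>
  have A': "(\<forall>t\<ge>1. 1 \<star> t = 1) \<or> (\<forall>t>0. t \<le> 1 \<star> t)"
    using op.idempotent_slice(1)[OF assms]
  proof
    assume *: "\<forall>t. 0 < t \<and> t \<le> 1 \<longrightarrow> t \<star> 1 = t"
    have "1 \<star> t = 1" if "t \<ge> 1" for t using *[rule_format, of "1 / t"] r[of t] that by simp
    then show ?thesis by blast
  next
    assume *: "\<forall>t\<ge>0. 1 \<le> t \<star> 1"
    have "t \<le> 1 \<star> t" if "t > 0" for t using *[rule_format, of "1 / t"] r[of t] that by simp
    then show ?thesis by blast
  qed
  have B': "(\<forall>t. 0 < t \<and> t \<le> 1 \<longrightarrow> 1 \<star> t = 1) \<or> (\<forall>t>0. 1 \<star> t \<le> t)"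
    using op.idempotent_slice(2)[OF assms]
  proof
    assume *: "\<forall>t\<ge>1. t \<star> 1 = t"
    have "1 \<star> t = 1" if "0 < t" "t \<le> 1" for t using *[rule_format, of "1 / t"] r[of t] that by simp
    then show ?thesis by blast
  next
    assume *: "\<forall>t\<ge>0. t \<star> 1 \<le> 1"
    have "1 \<star> t \<le> t" if "t > 0" for t using *[rule_format, of "1 / t"] r[of t] that by simp
    then show ?thesis by blast
  qed
  note A = idempotent_slice(1)[OF assms] and B = idempotent_slice(2)[OF assms]
  \<comment> \<open>Of the four combinations of \<open>A\<close> and \<open>B\<close>, two determine
    the slice at once and give the projections. The mixed ones leave one side of 1 open, which
    \<open>A'\<close> or \<open>B'\<close> settles, and give \<open>min\<close> and
    \<open>max\<close>.\<close>
  have slices: "(\<forall>t>0. 1 \<star> t = t) \<or> (\<forall>t>0. 1 \<star> t = min 1 t) \<or> (\<forall>t>0. 1 \<star> t = max 1 t) \<or> (\<forall>t>0. 1 \<star> t = 1)"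
    using A
  proof
    assume a: "\<forall>t. 0 < t \<and> t \<le> 1 \<longrightarrow> 1 \<star> t = t"
    show ?thesis using B
    proof
      assume "\<forall>t\<ge>1. 1 \<star> t = t"
      then show ?thesis using a by (meson linear)
    next
      assume b: "\<forall>t\<ge>0. 1 \<star> t \<le> 1"
      \<comment> \<open>The value at 2 excludes the second alternative of \<open>A'\<close>; in the
        other mixed case the value at 1/2 does the same for \<open>B'\<close>.\<close>
      then have "\<not> 2 \<le> 1 \<star> 2" by (smt (verit))
      then have "\<forall>t\<ge>1. 1 \<star> t = 1" using A' zero_less_numeral by blast
      then have "\<forall>t>0. 1 \<star> t = min 1 t" using a by (auto simp: min_def)
      then show ?thesis by blast
    qed
  next
    assume a: "\<forall>t\<ge>0. 1 \<le> 1 \<star> t"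
    show ?thesis using B
    proof
      assume b: "\<forall>t\<ge>1. 1 \<star> t = t"
      have "\<not> 1 \<star> (1 / 2) \<le> 1 / 2" using a[rule_format, of "1/2"] by simp
      moreover have "(1 / 2 :: real) > 0" by simp
      ultimately have "\<forall>t. 0 < t \<and> t \<le> 1 \<longrightarrow> 1 \<star> t = 1" using B' by blast
      then have "\<forall>t>0. 1 \<star> t = max 1 t" using b by (auto simp: max_def)
      then show ?thesis by blast
    next
      assume b: "\<forall>t\<ge>0. 1 \<star> t \<le> 1"
      then show ?thesis using a by (meson antisym less_imp_le)
    qed
  qed
  have ext: "\<forall>s\<ge>0. \<forall>t\<ge>0. s \<star> t = g s t"
    if "continuous_on ({0..} \<times> {0..}) (\<lambda>z. g (fst z) (snd z))" "\<forall>t>0. 1 \<star> t = g 1 t"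
      "\<And>s t. 0 < s \<Longrightarrow> 0 < t \<Longrightarrow> s * g 1 (t / s) = g s t" for g
  proof (intro allI impI, rule eqI_pos[OF that(1)])
    fix s t :: real assume st: "0 < s" "0 < t"
    have "s \<star> t = s * (1 \<star> (t / s))" using st by (intro eq_slice) auto
    then show "s \<star> t = g s t" using that(2) that(3)[OF st] st by simp
  qed
  show ?thesis
    using slices
  proof (elim disjE)
    assume "\<forall>t>0. 1 \<star> t = t"
    then have "\<forall>s\<ge>0. \<forall>t\<ge>0. s \<star> t = t" by (intro ext continuous_intros) auto
    then show ?thesis by blast
  next
    assume "\<forall>t>0. 1 \<star> t = min 1 t"
    then have "\<forall>s\<ge>0. \<forall>t\<ge>0. s \<star> t = min s t"
      by (intro ext continuous_intros) (auto simp: min_def field_simps)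
    then show ?thesis by blast
  next
    assume "\<forall>t>0. 1 \<star> t = max 1 t"
    then have "\<forall>s\<ge>0. \<forall>t\<ge>0. s \<star> t = max s t"
      by (intro ext continuous_intros) (auto simp: max_def field_simps)
    then show ?thesis by blast
  next
    assume "\<forall>t>0. 1 \<star> t = 1"
    then have "\<forall>s\<ge>0. \<forall>t\<ge>0. s \<star> t = s"
      by (intro ext[of "\<lambda>s t. s"] continuous_on_fst continuous_on_id) auto
    then show ?thesis by blast
  qed
qed

subsection \<open>The zero operation\<close>

text \<open>If \<open>1 \<star> 1 = 0\<close>, the slice \<open>h\<close> is a continuous involution
  exchanging 0 and 1. Between 1 and \<open>h 2\<close> it runs from 0 to 2, so it takes the value 1
  at a positive point; but 0 is the only preimage of 1.\<close>

lemma one_one_nonzero_if_axes_identity: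
  assumes "1 \<star> 0 = 1" "0 \<star> 1 = 1"
  shows "1 \<star> 1 \<noteq> 0"
proof
  assume c: "1 \<star> 1 = 0"
  define h where "h = (\<lambda>t. 1 \<star> t)"
  have h0: "h 0 = 1" and h1: "h 1 = 0" using assms c by (auto simp: h_def)
  have inv: "h (h t) = t" if "0 \<le> t" for t
    using that assoc[of 1 1 t] c zero_op[of t] assms by (simp add: h_def)
  have pos: "0 \<le> h t" if "0 \<le> t" for t using that nonneg by (simp add: h_def)
  have cont_h: "continuous_on {0..} h"
    unfolding h_def by (intro continuous_on_op continuous_intros) auto
  define u where "u = h 2"
  have u: "0 \<le> u" "h u = 2" using inv[of 2] pos[of 2] by (auto simp: u_def)
  have "u \<noteq> 0" using u h0 by auto
  show False
  proof (cases "u \<le> 1")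
    case True
    have "\<exists>x\<ge>u. x \<le> 1 \<and> h x = 1"
      by (rule IVT2') (use u h1 True in \<open>auto intro: continuous_on_subset[OF cont_h]\<close>)
    then obtain x where "u \<le> x" "h x = 1" by blast
    then have "x = 0" using inv[of x] h1 u by simp
    then show False using \<open>u \<le> x\<close> u \<open>u \<noteq> 0\<close> by simp
  next
    case False
    have "\<exists>x\<ge>1. x \<le> u \<and> h x = 1"
      by (rule IVT') (use u h1 False in \<open>auto intro: continuous_on_subset[OF cont_h]\<close>)
    then obtain x where "1 \<le> x" "h x = 1" by blast
    then show False using inv[of x] h1 by simp
  qed
qed

text \<open>The set \<open>U = {u. 0 < 1 \<star> u}\<close> is mapped into itself by scaling with \<open>(1 \<star> t) / t\<close>, \<open>t \<in> U\<close>, and by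
  continuity these factors are arbitrarily small; but \<open>1 \<star> u\<close> vanishes for all small \<open>u\<close>, because these
  are themselves of the form \<open>1 \<star> y\<close> and \<open>1 \<star> (1 \<star> y) = (1 \<star> 1) \<star> y = 0\<close>.\<close>

lemma zero_operation:
  assumes "1 \<star> 1 = 0" "0 \<le> s" "0 \<le> t"
  shows "s \<star> t = 0"
proof -
  have ax: "1 \<star> 0 = 0" "0 \<star> 1 = 0"
    using one_one_if_axes_differ one_zero_cases zero_one_cases one_one_nonzero_if_axes_identity assms(1)
    by (metis zero_neq_one)+
  have cont_h: "continuous_on {0..} (\<lambda>t. 1 \<star> t)"
    by (intro continuous_on_op continuous_intros) auto
  \<comment> \<open>Associativity rewrites the positive number
    \<open>(1 \<star> t) * (1 \<star> u)\<close> as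
    \<open>1 \<star> (t \<star> ((1 \<star> t) * u))\<close>. As \<open>1 \<star> 0 = 0\<close>, the
    inner product cannot vanish.\<close>
  have scale: "0 < 1 \<star> ((1 \<star> t) / t * u)" if "0 < t" "0 < 1 \<star> t" "0 < u" "0 < 1 \<star> u" for t u
  proof -
    have "0 < (1 \<star> t) * (1 \<star> u)" using that by simp
    also have "\<dots> = (1 \<star> t) \<star> ((1 \<star> t) * u)"
      using homog[of "1 \<star> t" 1 u] that by simp
    also have "\<dots> = 1 \<star> (t \<star> ((1 \<star> t) * u))"
      using that by (intro assoc[symmetric]) auto
    finally have "t \<star> ((1 \<star> t) * u) \<noteq> 0" using ax by auto
    moreover have "t \<star> ((1 \<star> t) * u) = t * (1 \<star> ((1 \<star> t) * u / t))"
      using that by (intro eq_slice) auto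
    ultimately have "1 \<star> ((1 \<star> t) * u / t) \<noteq> 0" by auto
    then show ?thesis using nonneg[of 1 "(1 \<star> t) * u / t"] that by (simp add: less_le)
  qed
  have slice: "1 \<star> u = 0" if "0 < u" for u
  proof (rule ccontr)
    assume "1 \<star> u \<noteq> 0"
    define b where "b = 1 \<star> u"
    have b: "0 < b" using \<open>1 \<star> u \<noteq> 0\<close> nonneg[of 1 u] that by (simp add: b_def)
    have onto: "\<exists>x. min 1 u \<le> x \<and> 1 \<star> x = v" if v: "0 \<le> v" "v \<le> b" for v
    proof (cases "u \<le> 1")
      case True
      have "\<exists>x\<ge>u. x \<le> 1 \<and> 1 \<star> x = v"
        by (rule IVT2') (use True v that \<open>0 < u\<close> assms(1) b_def in \<open>auto intro: continuous_on_subset[OF cont_h]\<close>)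
      then show ?thesis using True by auto
    next
      case False
      have "\<exists>x\<ge>1. x \<le> u \<and> 1 \<star> x = v"
        by (rule IVT') (use False v that \<open>0 < u\<close> assms(1) b_def in \<open>auto intro: continuous_on_subset[OF cont_h]\<close>)
      then show ?thesis using False by auto
    qed
    \<comment> \<open>Chosen so that \<open>v\<close> is a slice value at some
      \<open>x \<ge> min 1 u\<close> and the rescaled point \<open>v / x * u\<close> is still at
      most \<open>b\<close>, hence a slice value itself.\<close>
    define v where "v = b * min 1 u / max 1 u"
    have v: "0 < v" "v \<le> b" "v * u \<le> b * min 1 u"
      using b that by (auto simp: v_def min_def max_def field_simps)
    obtain x where x: "min 1 u \<le> x" "1 \<star> x = v" using onto[of v] v by auto
    have x0: "0 < x" using x(1) that by linarith
    have "v * u \<le> b * x" using v(3) mult_left_mono[OF x(1), of b] b by linarith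
    then have "v / x * u \<le> b" using x0 by (simp add: field_simps)
    moreover have "0 \<le> v / x * u" using v x0 that by simp
    ultimately obtain y where y: "min 1 u \<le> y" "1 \<star> y = v / x * u"
      using onto by blast
    have "1 \<star> (1 \<star> y) = 0"
      using assoc[of 1 1 y] y(1) that zero_op[of y] ax assms(1) by simp
    moreover have "0 < 1 \<star> (v / x * u)" using scale[of x u] x v x0 b that by (simp add: b_def)
    ultimately show False using y by simp
  qed
  show ?thesis
  proof (cases "s = 0 \<or> t = 0")
    case True
    then show ?thesis using op_zero[of s] zero_op[of t] ax assms by auto
  next
    case False
    then show ?thesis using eq_slice[of s t] slice[of "t / s"] assms by simp
  qed
qed

end

subsection \<open>Power sums\<close>

text \<open>With \<open>L = ln (a 2)\<close>, comparing \<open>n ^ k\<close> with consecutive powers of \<open>2\<close> yields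
  \<open>\<bar>k * (ln (a n) - L / ln 2 * ln n)\<bar> \<le> L\<close> for all \<open>k\<close>.\<close>

lemma mono_multiplicative_eq_powr:
  fixes a :: "nat \<Rightarrow> real"
  assumes pos: "\<And>n. 1 \<le> n \<Longrightarrow> 0 < a n"
    and mult: "\<And>m n. 1 \<le> m \<Longrightarrow> 1 \<le> n \<Longrightarrow> a (m * n) = a m * a n"
    and mono: "\<And>m n. 1 \<le> m \<Longrightarrow> m \<le> n \<Longrightarrow> a m \<le> a n"
    and n: "1 \<le> n"
  shows "a n = real n powr log 2 (a 2)"
proof -
  have a1: "a 1 = 1" using mult[of 1 1] pos[of 1] by simp
  have pow: "a (n ^ k) = a n ^ k" if "1 \<le> n" for n k
    using that by (induction k) (auto simp: a1[simplified] mult)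
  define L where "L = ln (a 2)"
  have L: "0 \<le> L" using mono[of 1 2] a1 by (simp add: L_def)
  define D where "D = ln (a n) - L / ln 2 * ln n"
  have bound: "\<bar>real k * D\<bar> \<le> L" for k
  proof -
    have "1 \<le> n ^ k" using n by simp
    then obtain j where j: "2 ^ j \<le> n ^ k" "n ^ k < 2 ^ (j + 1)"
      using ex_power_ivl1[of 2 "n ^ k"] by auto
    have "ln (real (2 ^ j)) \<le> ln (real (n ^ k))" "ln (real (n ^ k)) \<le> ln (real (2 ^ (j + 1)))"
      using j n by (simp_all del: of_nat_power)
    then have 1: "j * ln 2 \<le> k * ln n" "k * ln n \<le> (j + 1) * ln 2"
      using n by (simp_all add: ln_realpow del: power_Suc)
    have "a 2 ^ j \<le> a n ^ k" "a n ^ k \<le> a 2 ^ (j + 1)"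
      using mono[of "2 ^ j" "n ^ k"] mono[of "n ^ k" "2 ^ (j + 1)"] j pow[of 2 j] pow[of 2 "j + 1"] pow[of n k] n
      by simp_all
    then have "ln (a 2 ^ j) \<le> ln (a n ^ k)" "ln (a n ^ k) \<le> ln (a 2 ^ (j + 1))"
      using pos[of 2] pos[of n] n by simp_all
    then have 2: "j * L \<le> k * ln (a n)" "k * ln (a n) \<le> (j + 1) * L"
      using pos[of 2] pos[of n] n by (simp_all add: ln_realpow L_def del: power_Suc)
    have 3: "j * L \<le> L / ln 2 * (k * ln n)" "L / ln 2 * (k * ln n) \<le> (j + 1) * L"
      using mult_left_mono[OF 1(1), of "L / ln 2"] mult_left_mono[OF 1(2), of "L / ln 2"] L
      by (simp_all add: field_simps)
    have "real k * D = k * ln (a n) - L / ln 2 * (k * ln n)" by (simp add: D_def algebra_simps)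
    then show ?thesis using 2 3 by (simp add: abs_le_iff algebra_simps)
  qed
  have "D = 0"
  proof (rule ccontr)
    assume "D \<noteq> 0"
    then obtain k where "L < real k * \<bar>D\<bar>" using reals_Archimedean3[of "\<bar>D\<bar>"] by auto
    then show False using bound[of k] by (simp add: abs_mult)
  qed
  then have "ln (a n) = log 2 (a 2) * ln n" by (simp add: D_def L_def log_def)
  then have "exp (ln (a n)) = exp (log 2 (a 2) * ln n)" by simp
  then show ?thesis using pos[OF n] n by (simp add: powr_def)
qed

text \<open>For \<open>p < 0\<close> the value on the axes must be set to 0 explicitly: since
  \<open>0 powr p = 0\<close>, the bare formula would return the other argument there.\<close>

definition power_sum :: "real \<Rightarrow> real \<Rightarrow> real \<Rightarrow> real" where
  "power_sum p s t =
     (if 0 < p \<or> 0 < s \<and> 0 < t then (s powr p + t powr p) powr (1 / p) else 0)"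

section \<open>Iterated products of 1 and their growth\<close>

context homogeneous_semigroup
begin

text \<open>The product of \<open>n\<close> factors 1 needs \<open>n - 1\<close> multiplications. At
  0 truncated subtraction gives the junk value 1, whence the recurring condition
  \<open>1 \<le> n\<close>.\<close>

definition unit_power :: "nat \<Rightarrow> real" where
  "unit_power n = ((\<lambda>x. 1 \<star> x) ^^ (n - 1)) 1"

lemma unit_power_1: "unit_power 1 = 1"
  by (simp add: unit_power_def)

lemma unit_power_Suc: "1 \<le> n \<Longrightarrow> unit_power (Suc n) = 1 \<star> unit_power n"
  by (cases n) (auto simp: unit_power_def)

lemma unit_power_2: "unit_power 2 = 1 \<star> 1"
  using unit_power_Suc[of 1] unit_power_1 by (simp add: numeral_2_eq_2)

lemma unit_power_nonneg: "1 \<le> n \<Longrightarrow> 0 \<le> unit_power n"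
  by (induction n rule: dec_induct) (auto simp: unit_power_1 unit_power_Suc nonneg simp del: One_nat_def)

lemma unit_power_add:
  assumes "1 \<le> k" "1 \<le> n"
  shows "unit_power (k + n) = unit_power k \<star> unit_power n"
  using assms
proof (induction k rule: dec_induct)
  case base
  then show ?case using unit_power_Suc[of n] unit_power_1 by simp
next
  case (step k)
  then have "unit_power (Suc k + n) = 1 \<star> (unit_power k \<star> unit_power n)"
    using unit_power_Suc[of "k + n"] by simp
  also have "\<dots> = unit_power (Suc k) \<star> unit_power n"
    using step assoc[of 1 "unit_power k" "unit_power n"] unit_power_Suc[of k] unit_power_nonneg by simp
  finally show ?case .
qed

text \<open>In the induction step homogeneity pulls the common factor \<open>unit_power n\<close>
  out of a product, turning addition of indices into multiplication of values.\<close>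

lemma unit_power_mult:
  assumes "1 \<le> k" "1 \<le> n"
  shows "unit_power (k * n) = unit_power k * unit_power n"
  using assms
proof (induction k rule: dec_induct)
  case base
  then show ?case using unit_power_1 by simp
next
  case (step k)
  then have "unit_power (Suc k * n) = unit_power n \<star> unit_power (k * n)"
    using unit_power_add[of n "k * n"] by simp
  also have "\<dots> = (unit_power n * 1) \<star> (unit_power n * unit_power k)"
    using step by (simp add: mult.commute)
  also have "\<dots> = unit_power n * unit_power (Suc k)"
    using step homog[of "unit_power n" 1 "unit_power k"] unit_power_nonneg unit_power_Suc[of k] by simp
  finally show ?case by (simp add: mult.commute)
qed

lemma unit_power_pow2: "unit_power (2 ^ k) = (1 \<star> 1) ^ k"
  by (induction k) (auto simp: unit_power_1[simplified] unit_power_mult unit_power_2)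

text \<open>With \<open>s = x powr q\<close> and \<open>t = y powr q\<close> the claim is that the
  product equals \<open>(x + y) powr q\<close>. For fractions \<open>i / N\<close> and
  \<open>j / N\<close> this is \<open>unit_power_add\<close> scaled by
  \<open>(1 / N) powr q\<close>; continuity does the rest.\<close>

lemma op_eq_of_unit_power_eq_powr:
  assumes q: "q \<noteq> 0" and eq: "\<And>n. 1 \<le> n \<Longrightarrow> unit_power n = real n powr q"
    and st: "0 < s" "0 < t"
  shows "s \<star> t = (s powr (1 / q) + t powr (1 / q)) powr q"
proof -
  \<comment> \<open>Rounding up to multiples of \<open>1 / Suc n\<close> gives \<open>x\<close> and
    \<open>y\<close> a common denominator and keeps the numerators at least 1.\<close>
  define r where "r = (\<lambda>x n. real (nat \<lceil>real (Suc n) * x\<rceil>) / real (Suc n))"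
  have rpos: "0 < r x n" if "0 < x" for x n
  proof -
    have "0 < real (Suc n) * x" using that by simp
    then show ?thesis by (simp add: r_def del: of_nat_Suc)
  qed
  have lim: "r x \<longlonglongrightarrow> x" if "0 < x" for x
  proof (rule real_tendsto_sandwich)
    show "(\<lambda>n. x) \<longlonglongrightarrow> x" by simp
    show "(\<lambda>n. x + inverse (real (Suc n))) \<longlonglongrightarrow> x"
      using tendsto_add[OF tendsto_const[of x] LIMSEQ_inverse_real_of_nat] by simp
    have "x \<le> r x n \<and> r x n \<le> x + inverse (real (Suc n))" for n
    proof -
      define N where "N = real (Suc n)"
      have N: "0 < N" by (simp add: N_def)
      have "0 < N * x" using N that by simp
      then have "real (nat \<lceil>N * x\<rceil>) = of_int \<lceil>N * x\<rceil>" by simp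
      then have "N * x \<le> real (nat \<lceil>N * x\<rceil>)" "real (nat \<lceil>N * x\<rceil>) \<le> N * x + 1" by linarith+
      then show ?thesis unfolding r_def N_def[symmetric] using N by (simp add: field_simps)
    qed
    then show "\<forall>\<^sub>F n in sequentially. x \<le> r x n"
      "\<forall>\<^sub>F n in sequentially. r x n \<le> x + inverse (real (Suc n))" by auto
  qed
  have rat: "(r x n powr q) \<star> (r y n powr q) = (r x n + r y n) powr q" if xy: "0 < x" "0 < y" for x y n
  proof -
    define N where "N = real (Suc n)"
    define i where "i = nat \<lceil>N * x\<rceil>"
    define j where "j = nat \<lceil>N * y\<rceil>"
    have N: "0 < N" by (simp add: N_def)
    have "0 < N * x" "0 < N * y" using N xy by simp_all
    then have ij: "1 \<le> i" "1 \<le> j" unfolding i_def j_def by linarith+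
    have r: "r x n = real i / N" "r y n = real j / N" by (simp_all add: r_def N_def i_def j_def)
    have "(r x n powr q) \<star> (r y n powr q) =
        ((1 / N) powr q * unit_power i) \<star> ((1 / N) powr q * unit_power j)"
      using N ij by (simp add: r eq powr_divide)
    also have "\<dots> = (1 / N) powr q * unit_power (i + j)"
      using homog[of "(1 / N) powr q" "unit_power i" "unit_power j"] unit_power_add[OF ij]
        unit_power_nonneg ij by simp
    also have "\<dots> = (r x n + r y n) powr q"
      using eq[of "i + j"] N ij by (simp add: r powr_divide flip: add_divide_distrib)
    finally show ?thesis .
  qed
  define x where "x = s powr (1 / q)"
  define y where "y = t powr (1 / q)"
  have xy: "0 < x" "0 < y" using st by (auto simp: x_def y_def)
  have s: "s = x powr q" "t = y powr q" using st q by (simp_all add: x_def y_def powr_powr)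
  have "(\<lambda>n. (r x n powr q, r y n powr q)) \<longlonglongrightarrow> (x powr q, y powr q)"
    using xy by (intro tendsto_Pair tendsto_powr lim tendsto_const) auto
  then have "(\<lambda>n. (r x n powr q) \<star> (r y n powr q)) \<longlonglongrightarrow> (x powr q) \<star> (y powr q)"
    using continuous_on_tendsto_compose[OF cont, of "\<lambda>n. (r x n powr q, r y n powr q)" "(x powr q, y powr q)"]
    by simp
  moreover have "(\<lambda>n. (r x n + r y n) powr q) \<longlonglongrightarrow> (x + y) powr q"
    using xy by (intro tendsto_powr tendsto_add lim tendsto_const) auto
  ultimately have "(x powr q) \<star> (y powr q) = (x + y) powr q"
    using rat[OF xy] LIMSEQ_unique by simp
  then show ?thesis unfolding s[symmetric] by (simp only: x_def y_def)
qed

text \<open>If \<open>x\<close> minimises \<open>1 \<star> x\<close> then \<open>(1 \<star> x) \<star> w = 1 \<star> (x \<star> w) \<ge> 1 \<star> x\<close>; take \<open>w = (1 \<star> x) * t\<close>.\<close>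

lemma one_le_slice_if_axes_identity:
  assumes "1 \<star> 0 = 1" "0 \<star> 1 = 1" "0 \<le> t"
  shows "1 \<le> 1 \<star> t"
proof -
  have cont_h: "continuous_on {0..} (\<lambda>t. 1 \<star> t)"
    by (intro continuous_on_op continuous_intros) auto
  have cont_r: "continuous_on {0..} (\<lambda>t. t \<star> 1)"
    by (intro continuous_on_op continuous_intros) auto
  obtain d where d: "0 < d" "\<And>x. 0 \<le> x \<Longrightarrow> x < d \<Longrightarrow> \<bar>x \<star> 1 - 1\<bar> < 1 / 2"
    using cont_r[unfolded continuous_on_iff, rule_format, of 0 "1 / 2"] assms(2)
    by (auto simp: dist_real_def)
  \<comment> \<open>Beyond \<open>T\<close> the identity
    \<open>1 \<star> x = x * ((1 / x) \<star> 1)\<close> has factors at least 2 and 1/2. Since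
    \<open>1 \<star> 0 = 1\<close>, a minimum over \<open>{0..T}\<close> is therefore a global
    one.\<close>
  define T where "T = max 2 (2 / d)"
  have large: "1 \<le> 1 \<star> x" if "T \<le> x" for x
  proof -
    have x: "2 \<le> x" "2 / d \<le> x" using that by (auto simp: T_def)
    then have "1 / x < d" using d(1) by (simp add: field_simps)
    then have "\<bar>(1 / x) \<star> 1 - 1\<bar> < 1 / 2" using d(2)[of "1 / x"] x by simp
    then have "1 / 2 \<le> (1 / x) \<star> 1" by linarith
    then have "2 * (1 / 2) \<le> x * ((1 / x) \<star> 1)" using x by (intro mult_mono) auto
    then show ?thesis using eq_slice'[of 1 x] x by simp
  qed
  have "\<exists>x\<in>{0..T}. \<forall>y\<in>{0..T}. 1 \<star> x \<le> 1 \<star> y"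
    by (rule continuous_attains_inf) (auto simp: T_def intro: continuous_on_subset[OF cont_h])
  then obtain x where x: "0 \<le> x" "x \<le> T" and xmin: "\<And>y. 0 \<le> y \<Longrightarrow> y \<le> T \<Longrightarrow> 1 \<star> x \<le> 1 \<star> y"
    by auto
  have T0: "0 \<le> T" by (simp add: T_def)
  have min: "1 \<star> x \<le> 1 \<star> y" if "0 \<le> y" for y
  proof (cases "y \<le> T")
    case False
    then show ?thesis using xmin[of 0] large[of y] assms(1) T0 by simp
  qed (use that xmin in auto)
  \<comment> \<open>If the minimum were 0, then
    \<open>1 \<star> (x \<star> w) = 0 \<star> w = w\<close>, so multiplication by \<open>x\<close>
    from the left would be injective. But a point \<open>y\<close> with
    \<open>1 \<star> y = 1\<close> makes \<open>x \<star> (x * y)\<close> and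
    \<open>x \<star> 0\<close> coincide.\<close>
  have "1 \<star> x \<noteq> 0"
  proof
    assume z: "1 \<star> x = 0"
    then have x0: "0 < x" using x assms(1) by (cases "x = 0") auto
    have inv: "1 \<star> (x \<star> w) = w" if "0 \<le> w" for w
      using assoc[of 1 x w] z zero_op[of w] assms(2) that x by simp
    have "\<exists>y\<ge>x. y \<le> T \<and> 1 \<star> y = 1"
      by (rule IVT') (use x z large[of T] in \<open>auto intro: continuous_on_subset[OF cont_h]\<close>)
    then obtain y where y: "x \<le> y" "1 \<star> y = 1" by blast
    have "x \<star> (x * y) = x \<star> 0"
      using homog[of x 1 y] homog[of x 1 0] x y assms(1) by simp
    then have "x * y = 0" using inv[of "x * y"] inv[of 0] x y by simp
    then show False using x0 y by simp
  qed
  then have m: "0 < 1 \<star> x" using nonneg[of 1 x] x by simp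
  have "(1 \<star> x) * 1 \<le> 1 \<star> (x \<star> ((1 \<star> x) * t))"
    using min[of "x \<star> ((1 \<star> x) * t)"] nonneg[of x "(1 \<star> x) * t"] x m assms by simp
  also have "\<dots> = (1 \<star> x) * (1 \<star> t)"
    using assoc[of 1 x "(1 \<star> x) * t"] homog[of "1 \<star> x" 1 t] x m assms by simp
  finally show ?thesis using m by simp
qed

text \<open>The range of the slice is an interval containing 0, 1 and a value above 1. It is closed
  under multiplication by homogeneity and associativity, hence is the whole half-line.\<close>

lemma slice_surj_if_exceeds_one:
  assumes "1 \<star> 0 = 0" "0 \<le> t" "1 < 1 \<star> t" "0 \<le> v"
  shows "\<exists>x\<ge>0. 1 \<star> x = v"
proof -
  define F where "F = (\<lambda>t. 1 \<star> t) ` {0..}"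
  have con: "connected F"
    unfolding F_def by (intro connected_continuous_image continuous_on_op continuous_intros) auto
  have F0: "0 \<in> F" using assms by (force simp: F_def)
  have Ft: "1 \<star> t \<in> F" using assms by (simp add: F_def)
  have F1: "1 \<in> F" using connectedD_interval[OF con F0 Ft] assms by simp
  have mult: "a * b \<in> F" if ab: "a \<in> F" "b \<in> F" for a b
  proof -
    obtain x y where xy: "0 \<le> x" "0 \<le> y" "a = 1 \<star> x" "b = 1 \<star> y" using ab by (auto simp: F_def)
    then have nn: "0 \<le> a" "0 \<le> b" using nonneg by auto
    have "a * b = a \<star> (a * y)" using homog[of a 1 y] xy nn by simp
    also have "\<dots> = 1 \<star> (x \<star> (a * y))" using assoc[of 1 x "a * y"] xy(1,2) nn xy(3) by simp
    finally show ?thesis using nonneg[of x "a * y"] xy nn by (simp add: F_def)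
  qed
  have "v \<in> F"
  proof (cases "v \<le> 1")
    case True
    then show ?thesis using connectedD_interval[OF con F0 F1] assms by simp
  next
    case False
    then show ?thesis using connected_mult_closed_atLeast[OF con F1 mult Ft assms(3)] by simp
  qed
  then show ?thesis by (auto simp: F_def)
qed


text \<open>If both slices exceeded 1, both would be surjective. Taking
  \<open>s \<star> 1 = 1\<close> and \<open>1 \<star> w = s\<close> gives
  \<open>s \<star> s = (s \<star> 1) \<star> w = s\<close> with \<open>s \<noteq> 0\<close>, so
  \<open>1 \<star> 1 = 1\<close> by homogeneity.\<close>

lemma slice_le_one_if_axes_zero:
  assumes "1 \<star> 0 = 0" "0 \<star> 1 = 0" "1 \<star> 1 \<noteq> 1"
  shows "(\<forall>t\<ge>0. 1 \<star> t \<le> 1) \<or> (\<forall>t\<ge>0. t \<star> 1 \<le> 1)"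
proof (rule ccontr)
  assume "\<not> ?thesis"
  then obtain u v where uv: "0 \<le> u" "1 < 1 \<star> u" "0 \<le> v" "1 < v \<star> 1" by (auto simp: not_le)
  obtain s where s: "0 \<le> s" "s \<star> 1 = 1"
    using homogeneous_semigroup.slice_surj_if_exceeds_one[OF opposite, of v 1] uv assms by auto
  obtain w where w: "0 \<le> w" "1 \<star> w = s"
    using slice_surj_if_exceeds_one[of u s] uv assms s by auto
  have "s \<star> s = s" using assoc[of s 1 w] s w by simp
  moreover have "s \<noteq> 0" using s assms by auto
  ultimately show False using diagonal[of s] s assms by simp
qed

text \<open>By associativity the bracketing of the factors 1 is irrelevant, so growth results for
  the opposite operation transfer back.\<close>

lemma unit_power_opposite:
  "1 \<le> n \<Longrightarrow> homogeneous_semigroup.unit_power (\<lambda>s t. t \<star> s) n = unit_power n"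
proof (induction n rule: dec_induct)
  case base
  show ?case using unit_power_1 homogeneous_semigroup.unit_power_1[OF opposite] by simp
next
  case (step n)
  then show ?case
    using unit_power_add[of n 1] unit_power_1 homogeneous_semigroup.unit_power_Suc[OF opposite, of n]
    by simp
qed

text \<open>\<open>unit_power (Suc n)\<close> is \<open>unit_power n\<close> times a slice value, so
  the sequence decreases. Its reciprocals are increasing and multiplicative, to which
  \<open>mono_multiplicative_eq_powr\<close> applies.\<close>

lemma unit_power_decreasing:
  assumes axis: "1 \<star> 0 = 0" and "1 \<star> 1 \<noteq> 0" and "\<forall>t\<ge>0. 1 \<star> t \<le> 1"
  shows "\<exists>q\<le>0. \<forall>n\<ge>1. unit_power n = real n powr q"
proof -
  \<comment> \<open>Positivity is not yet available, being derived from this monotonicity, so the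
    value 0 is treated separately.\<close>
  have Suc_step: "unit_power (Suc n) \<le> unit_power n" if "1 \<le> n" for n
  proof (cases "unit_power n = 0")
    case True
    then show ?thesis
      using unit_power_Suc[OF that] unit_power_add[OF that, of 1] unit_power_1
      by (simp add: axis)
  next
    case False
    then have p: "0 < unit_power n" using unit_power_nonneg[OF that] by simp
    have "unit_power (Suc n) = unit_power n * (1 \<star> (1 / unit_power n))"
      using unit_power_add[of n 1] unit_power_1 that eq_slice[OF p, of 1] by simp
    also have "\<dots> \<le> unit_power n * 1" using p assms(3) by (intro mult_left_mono) auto
    finally show ?thesis by simp
  qed
  have mono: "unit_power n \<le> unit_power k" if "1 \<le> k" "k \<le> n" for k n
    using that(2)
  proof (induction n rule: dec_induct)
    case (step n)
    then show ?case using Suc_step[of n] that by linarith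
  qed simp
  \<comment> \<open>At powers of 2 the value is a power of \<open>1 \<star> 1\<close> and so
    positive; monotonicity and \<open>n < 2 ^ n\<close> transfer this to \<open>n\<close>.\<close>
  have pos: "0 < unit_power n" if "1 \<le> n" for n
  proof -
    have "0 < (1 \<star> 1) ^ n" using assms(2) nonneg[of 1 1] by simp
    then have "0 < unit_power (2 ^ n)" using unit_power_pow2 by simp
    also have "\<dots> \<le> unit_power n" using that by (intro mono) (auto simp: less_imp_le)
    finally show ?thesis .
  qed
  have "inverse (unit_power n) = real n powr log 2 (inverse (unit_power 2))" if "1 \<le> n" for n
    by (rule mono_multiplicative_eq_powr) (use that in \<open>auto simp: pos[simplified] unit_power_mult[simplified] intro!: le_imp_inverse_le mono\<close>)
  then have "unit_power n = real n powr (- log 2 (inverse (unit_power 2)))" if "1 \<le> n" for n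
    using that by (metis inverse_inverse_eq powr_minus)
  moreover have "0 \<le> log 2 (inverse (unit_power 2))"
    using mono[of 1 2] pos[of 2] unit_power_1 by (simp add: one_le_inverse_iff)
  ultimately show ?thesis by (metis neg_le_0_iff_le)
qed

text \<open>Here all slice values are at least 1, so the sequence itself increases.\<close>

lemma unit_power_increasing:
  assumes "1 \<star> 0 = 1" "0 \<star> 1 = 1" "1 \<star> 1 \<noteq> 0"
  shows "\<exists>q\<ge>0. \<forall>n\<ge>1. unit_power n = real n powr q"
proof -
  have slice: "1 \<le> 1 \<star> t" if "0 \<le> t" for t using one_le_slice_if_axes_identity assms that by blast
  have pos: "1 \<le> unit_power n" if "1 \<le> n" for n
    using that by (induction n rule: dec_induct) (auto simp: unit_power_1 unit_power_Suc slice unit_power_nonneg simp del: One_nat_def)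
  have Suc_step: "unit_power n \<le> unit_power (Suc n)" if "1 \<le> n" for n
  proof -
    have p: "0 < unit_power n" using pos[OF that] by simp
    have "unit_power n * 1 \<le> unit_power n * (1 \<star> (1 / unit_power n))"
      using p slice by (intro mult_left_mono) auto
    also have "\<dots> = unit_power (Suc n)"
      using unit_power_add[of n 1] unit_power_1 that eq_slice[OF p, of 1] by simp
    finally show ?thesis by simp
  qed
  have mono: "unit_power k \<le> unit_power n" if "1 \<le> k" "k \<le> n" for k n
    using that(2)
  proof (induction n rule: dec_induct)
    case (step n)
    then show ?case using Suc_step[of n] that by linarith
  qed simp
  have "unit_power n = real n powr log 2 (unit_power 2)" if "1 \<le> n" for n
    by (rule mono_multiplicative_eq_powr)
      (use that pos in \<open>auto simp: unit_power_mult[simplified] intro: mono less_le_trans[OF zero_less_one]\<close>)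
  moreover have "0 \<le> log 2 (unit_power 2)" using pos[of 2] by simp
  ultimately show ?thesis by blast
qed

text \<open>Since \<open>1 \<star> 1 \<noteq> 1\<close>, the two axes agree: value 0 leads to
  decreasing unit powers, value 1 to increasing ones. The exponent \<open>q\<close> is nonzero
  because \<open>2 powr q = 1 \<star> 1 \<noteq> 1\<close>, and \<open>p = 1 / q\<close>.\<close>

lemma power_sum_cases:
  assumes "1 \<star> 1 \<noteq> 0" "1 \<star> 1 \<noteq> 1"
  shows "\<exists>p. p \<noteq> 0 \<and> (\<forall>s\<ge>0. \<forall>t\<ge>0. s \<star> t = power_sum p s t)"
proof -
  obtain q where q: "\<And>n. 1 \<le> n \<Longrightarrow> unit_power n = real n powr q"
    and axes: "1 \<star> 0 = 1 \<and> 0 \<star> 1 = 1 \<and> 0 \<le> q \<or> 1 \<star> 0 = 0 \<and> 0 \<star> 1 = 0 \<and> q \<le> 0"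
  proof (cases "1 \<star> 0 = 0")
    case True
    then have ax: "1 \<star> 0 = 0" "0 \<star> 1 = 0" using one_one_if_axes_differ assms by metis+
    from slice_le_one_if_axes_zero[OF ax assms(2)]
    have "\<exists>q\<le>0. \<forall>n\<ge>1. unit_power n = real n powr q"
    proof
      assume "\<forall>t\<ge>0. t \<star> 1 \<le> 1"
      then have "\<exists>q\<le>0. \<forall>n\<ge>1. homogeneous_semigroup.unit_power (\<lambda>s t. t \<star> s) n = real n powr q"
        by (rule homogeneous_semigroup.unit_power_decreasing[OF opposite ax(2) assms(1)])
      then show ?thesis using unit_power_opposite by auto
    qed (rule unit_power_decreasing[OF ax(1) assms(1)])
    then show ?thesis using that ax by blast
  next
    case False
    then have ax: "1 \<star> 0 = 1" "0 \<star> 1 = 1" using one_one_if_axes_differ one_zero_cases assms by metis+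
    then show ?thesis using that unit_power_increasing[OF ax assms(1)] by blast
  qed
  have "q \<noteq> 0" using q[of 2] unit_power_2 assms by auto
  have pos: "s \<star> t = (s powr (1 / q) + t powr (1 / q)) powr q" if "0 < s" "0 < t" for s t
    using op_eq_of_unit_power_eq_powr[OF \<open>q \<noteq> 0\<close> q] that by blast
  have "s \<star> t = power_sum (1 / q) s t" if st: "0 \<le> s" "0 \<le> t" for s t
  proof (cases "0 < s \<and> 0 < t")
    case True
    then show ?thesis using pos by (simp add: power_sum_def)
  next
    \<comment> \<open>On the axes the sign of \<open>q\<close> decides: for \<open>q > 0\<close>
      both sides return the other argument, for \<open>q < 0\<close> both are 0.\<close>
    case False
    then show ?thesis
      using axes \<open>q \<noteq> 0\<close> st op_zero[of s] zero_op[of t] by (auto simp: power_sum_def powr_powr)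
  qed
  then show ?thesis using \<open>q \<noteq> 0\<close> by (intro exI[of _ "1 / q"]) auto
qed

theorem classification:
  "(\<forall>s\<ge>0. \<forall>t\<ge>0. s \<star> t = 0) \<or> (\<forall>s\<ge>0. \<forall>t\<ge>0. s \<star> t = s) \<or> (\<forall>s\<ge>0. \<forall>t\<ge>0. s \<star> t = t) \<or>
   (\<forall>s\<ge>0. \<forall>t\<ge>0. s \<star> t = max s t) \<or> (\<forall>s\<ge>0. \<forall>t\<ge>0. s \<star> t = min s t) \<or>
   (\<exists>p. p \<noteq> 0 \<and> (\<forall>s\<ge>0. \<forall>t\<ge>0. s \<star> t = power_sum p s t))"
proof (cases "1 \<star> 1 = 0")
  case True
  then show ?thesis using zero_operation by blast
next
  case False
  then show ?thesis using idempotent_cases power_sum_cases by (cases "1 \<star> 1 = 1") blast+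
qed

end

section \<open>Star sets and radial functions\<close>

lemma sym_star_set_imp_star_set: "K \<in> sym_star_sets \<Longrightarrow> star_set K"
  by (simp add: sym_star_sets_def)

lemma radial_function_scaleR:
  assumes "star_set L" "x \<noteq> 0" "0 < r"
  shows "radial_function L (r *\<^sub>R x) = radial_function L x / r"
  using assms radial_function_mem[of L x] radial_function_ge[of L x]
  by (intro radial_function_eqI) (auto simp: field_simps)

lemma radial_function_minus:
  assumes "K \<in> sym_star_sets"
  shows "radial_function K (- x) = radial_function K x"
proof -
  have "c *\<^sub>R - x \<in> K \<longleftrightarrow> c *\<^sub>R x \<in> K" for c
  proof -
    have "- y \<in> K" if "y \<in> K" for y using that assms by (auto simp: sym_star_sets_def)
    from this[of "c *\<^sub>R x"] this[of "c *\<^sub>R - x"] show ?thesis by auto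
  qed
  then show ?thesis by (simp add: radial_function_def)
qed

lemma sym_star_setsI:
  assumes "star_set K" "\<And>x. x \<noteq> 0 \<Longrightarrow> radial_function K (- x) = radial_function K x"
  shows "K \<in> sym_star_sets"
proof -
  have "x \<in> K \<longleftrightarrow> - x \<in> K" for x
    using assms star_set_mem_iff[OF assms(1), of x] star_set_mem_iff[OF assms(1), of "- x"]
    by (cases "x = 0") auto
  then have "uminus ` K = K" by (auto simp: image_iff) (metis minus_minus)
  then show ?thesis using assms(1) by (simp add: sym_star_sets_def)
qed

lemma radial_function_bound:
  fixes K :: "(real ^ 'n) set"
  assumes "star_set K"
  obtains B where "0 \<le> B" "\<And>u. norm u = 1 \<Longrightarrow> radial_function K u \<le> B"
proof -
  obtain B where B: "\<And>x. x \<in> K \<Longrightarrow> norm x \<le> B"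
    using assms compact_imp_bounded bounded_iff unfolding star_set_def by metis
  have "0 \<le> B" using B[of 0] assms by (simp add: star_set_def)
  moreover have "radial_function K u \<le> B" if "norm u = 1" for u :: "real ^ 'n"
  proof -
    have "u \<noteq> 0" using that by auto
    then show ?thesis using B[OF radial_function_mem[OF assms]] that by fastforce
  qed
  ultimately show ?thesis using that by blast
qed

text \<open>Radial functions are bounded on the sphere, so the supremum in
  \<open>radial_dist\<close> really is an upper bound.\<close>

lemma abs_diff_le_radial_dist:
  fixes K L :: "(real ^ 'n) set"
  assumes "star_set K" "star_set L" "norm u = 1"
  shows "\<bar>radial_function K u - radial_function L u\<bar> \<le> radial_dist K L"
proof -
  obtain B where B: "\<And>u. norm u = 1 \<Longrightarrow> radial_function K u \<le> B" using radial_function_bound[OF assms(1)] by metis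
  obtain C where C: "\<And>u. norm u = 1 \<Longrightarrow> radial_function L u \<le> C" using radial_function_bound[OF assms(2)] by metis
  have "\<bar>radial_function K u - radial_function L u\<bar> \<le> B + C" if "norm u = 1" for u
  proof -
    have "u \<noteq> 0" using that by auto
    then show ?thesis
      using radial_function_nonneg[OF assms(1)] radial_function_nonneg[OF assms(2)] B[OF that] C[OF that]
      by (smt (verit))
  qed
  then have "bdd_above ((\<lambda>u. \<bar>radial_function K u - radial_function L u\<bar>) ` sphere 0 1)"
    by (intro bdd_aboveI2[of _ _ "B + C"]) auto
  then show ?thesis unfolding radial_dist_def using assms(3) by (intro cSUP_upper) auto
qed

lemma radial_dist_le:
  fixes K L :: "(real ^ 'n) set"
  assumes "\<And>u. norm u = 1 \<Longrightarrow> \<bar>radial_function K u - radial_function L u\<bar> \<le> e"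
  shows "radial_dist K L \<le> e"
proof -
  \<comment> \<open>A coordinate vector witnesses that the sphere is nonempty, as a least upper
    bound argument over the reals requires.\<close>
  have "axis undefined 1 \<in> sphere (0 :: real ^ 'n) 1" by (simp add: norm_axis_1)
  then show ?thesis unfolding radial_dist_def using assms by (intro cSUP_least) auto
qed

lemma radial_dist_nonneg:
  fixes K L :: "(real ^ 'n) set"
  assumes "star_set K" "star_set L"
  shows "0 \<le> radial_dist K L"
  using abs_diff_le_radial_dist[OF assms, of "axis undefined 1"] by (simp add: norm_axis_1)

lemma radial_function_image:
  assumes "inj A" "\<And>c x. A (c *\<^sub>R x) = c *\<^sub>R A x"
  shows "radial_function (A ` K) (A x) = radial_function K x"
  unfolding radial_function_def using assms by (simp flip: assms(2) add: inj_image_mem_iff)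

lemma star_set_linear_image:
  fixes K :: "(real ^ 'n) set" and A :: "real ^ 'n \<Rightarrow> real ^ 'n"
  assumes "star_set K" "linear A"
  shows "star_set (A ` K)"
proof (rule star_setI)
  show "compact (A ` K)"
    using assms linear_continuous_on[of A]
    by (auto simp: star_set_def linear_conv_bounded_linear intro: compact_continuous_image)
  show "0 \<in> A ` K"
    using assms linear_0[OF assms(2)] by (force simp: star_set_def)
  fix x c assume "x \<in> A ` K" "0 \<le> c" "c \<le> (1 :: real)"
  then show "c *\<^sub>R x \<in> A ` K"
    using star_set_scale[OF assms(1)] linear_scale[OF assms(2)] by (metis (no_types, lifting) imageE imageI)
qed

lemma sym_star_sets_linear_image:
  fixes K :: "(real ^ 'n) set" and A :: "real ^ 'n \<Rightarrow> real ^ 'n"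
  assumes "K \<in> sym_star_sets" "linear A"
  shows "A ` K \<in> sym_star_sets"
proof -
  have "uminus ` A ` K = A ` uminus ` K"
    using linear_neg[OF assms(2)] by (simp add: image_image)
  then show ?thesis using assms star_set_linear_image by (auto simp: sym_star_sets_def)
qed

text \<open>The line through \<open>x\<close> either lies in \<open>S\<close> or meets it only in
  the origin.\<close>

lemma radial_function_Int_subspace:
  assumes "subspace S"
  shows "x \<in> S \<Longrightarrow> radial_function (K \<inter> S) x = radial_function K x"
    and "0 \<in> K \<Longrightarrow> x \<notin> S \<Longrightarrow> radial_function (K \<inter> S) x = 0"
proof -
  assume "x \<in> S"
  then show "radial_function (K \<inter> S) x = radial_function K x"
    unfolding radial_function_def using subspace_scale[OF assms] by simp
next
  assume K: "0 \<in> K" and x: "x \<notin> S"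
  have "c = 0" if "c *\<^sub>R x \<in> S" for c
  proof (rule ccontr)
    assume "c \<noteq> 0"
    then show False using subspace_scale[OF assms that, of "1 / c"] x by simp
  qed
  then show "radial_function (K \<inter> S) x = 0"
    using K subspace_0[OF assms] by (intro radial_function_eqI) auto
qed

lemma star_set_Int_subspace:
  assumes "star_set K" "subspace S"
  shows "star_set (K \<inter> S)"
proof (rule star_setI)
  show "compact (K \<inter> S)"
    using assms closed_subspace by (auto simp: star_set_def intro: compact_Int_closed)
qed (use assms in \<open>auto simp: star_set_def subspace_0 intro: star_set_scale[OF assms(1)] subspace_scale\<close>)

lemma sym_star_sets_Int_subspace:
  assumes "K \<in> sym_star_sets" "subspace S"
  shows "K \<inter> S \<in> sym_star_sets"
proof (rule sym_star_setsI)
  show "star_set (K \<inter> S)" using assms star_set_Int_subspace sym_star_set_imp_star_set by blast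
  have "0 \<in> K" using assms(1) by (simp add: sym_star_sets_def star_set_def)
  moreover have "- x \<in> S \<longleftrightarrow> x \<in> S" for x
    using subspace_neg[OF assms(2), of x] subspace_neg[OF assms(2), of "- x"] by auto
  ultimately show "radial_function (K \<inter> S) (- x) = radial_function (K \<inter> S) x" for x
    using radial_function_Int_subspace[OF assms(2), where K = K] radial_function_minus[OF assms(1), of x]
    by (cases "x \<in> S") auto
qed

lemma star_set_singleton_zero: "star_set {0}"
  by (rule star_setI) auto

lemma radial_function_singleton_zero: "x \<noteq> 0 \<Longrightarrow> radial_function {0} x = 0"
  by (rule radial_function_eqI) auto

lemma radial_function_Un:
  assumes "star_set K" "star_set L"
  shows "star_set (K \<union> L)"
    and "x \<noteq> 0 \<Longrightarrow> radial_function (K \<union> L) x = max (radial_function K x) (radial_function L x)"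
proof -
  show "star_set (K \<union> L)"
  proof (rule star_setI)
    show "compact (K \<union> L)" using assms by (auto simp: star_set_def)
  qed (use assms star_set_scale in \<open>auto simp: star_set_def\<close>)
  assume x: "x \<noteq> 0"
  show "radial_function (K \<union> L) x = max (radial_function K x) (radial_function L x)"
    using radial_function_mem[OF assms(1) x] radial_function_mem[OF assms(2) x]
      radial_function_ge[OF assms(1) x] radial_function_ge[OF assms(2) x]
    by (intro radial_function_eqI) (force simp: max_def intro: order_trans)+
qed

lemma radial_function_Int:
  assumes "star_set K" "star_set L"
  shows "star_set (K \<inter> L)"
    and "x \<noteq> 0 \<Longrightarrow> radial_function (K \<inter> L) x = min (radial_function K x) (radial_function L x)"
proof -
  show "star_set (K \<inter> L)"
  proof (rule star_setI)
    show "compact (K \<inter> L)" using assms by (auto simp: star_set_def)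
  qed (use assms star_set_scale in \<open>auto simp: star_set_def\<close>)
  assume x: "x \<noteq> 0"
  \<comment> \<open>Star-shapedness is what puts the smaller radial value into the set with the
    larger one.\<close>
  have mem: "c *\<^sub>R x \<in> M" if M: "star_set M" and c: "0 \<le> c" "c \<le> radial_function M x" for M c
  proof (cases "c = 0")
    case True
    then show ?thesis using M by (simp add: star_set_def)
  next
    case False
    then show ?thesis
      using star_set_mem_iff[OF M, of "c *\<^sub>R x"] radial_function_scaleR[OF M x, of c] c x by simp
  qed
  have "0 \<le> min (radial_function K x) (radial_function L x)"
    using radial_function_nonneg[OF assms(1) x] radial_function_nonneg[OF assms(2) x] by simp
  then show "radial_function (K \<inter> L) x = min (radial_function K x) (radial_function L x)"
    using mem[OF assms(1)] mem[OF assms(2)] radial_function_ge[OF assms(1) x] radial_function_ge[OF assms(2) x]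
    by (intro radial_function_eqI) auto
qed

text \<open>Radial values are nonnegative, so the equation between \<open>p\<close>-th powers can be
  solved for the radial function of \<open>M\<close>.\<close>

lemma is_radial_sum_iff:
  assumes "star_set K" "star_set L" "p \<noteq> 0"
  shows "is_radial_sum p K L M \<longleftrightarrow> star_set M \<and>
    (\<forall>x. x \<noteq> 0 \<longrightarrow> radial_function M x = power_sum p (radial_function K x) (radial_function L x))"
proof -
  have powr_iff: "a powr p = c \<longleftrightarrow> a = c powr (1 / p)" if "0 \<le> a" "0 \<le> c" for a c
    using that assms(3) by (auto simp: powr_powr)
  have "(if 0 < p \<or> 0 < radial_function K x \<and> 0 < radial_function L x
        then radial_function M x powr p = radial_function K x powr p + radial_function L x powr p
        else radial_function M x = 0) \<longleftrightarrow>
      radial_function M x = power_sum p (radial_function K x) (radial_function L x)"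
    if "star_set M" "x \<noteq> 0" for x
    using powr_iff[OF radial_function_nonneg[OF that], of "radial_function K x powr p + radial_function L x powr p"]
    by (auto simp: power_sum_def)
  then show ?thesis unfolding is_radial_sum_def by blast
qed

lemma radial_function_radial_sum:
  assumes "star_set K" "star_set L" "p \<noteq> 0"
  shows "star_set (radial_sum (ereal p) K L)"
    and "x \<noteq> 0 \<Longrightarrow> radial_function (radial_sum (ereal p) K L) x =
      power_sum p (radial_function K x) (radial_function L x)"
proof -
  have "is_radial_sum p K L (radial_sum (ereal p) K L)"
    using theI'[OF is_radial_sum_ex1[OF assms]] by (simp add: radial_sum_def)
  then show "star_set (radial_sum (ereal p) K L)"
    and "x \<noteq> 0 \<Longrightarrow> radial_function (radial_sum (ereal p) K L) x =
      power_sum p (radial_function K x) (radial_function L x)"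
    using is_radial_sum_iff[OF assms] by blast+
qed

section \<open>Segments\<close>

text \<open>These are the sections of symmetric star sets by lines; \<open>s\<close> counts
  multiples of \<open>u\<close> and is the half-length when \<open>u\<close> is a unit
  vector.\<close>

definition segment :: "real \<Rightarrow> real ^ 'n \<Rightarrow> (real ^ 'n) set" where
  "segment s u = (\<lambda>c. c *\<^sub>R u) ` {- s..s}"

lemma segment_sym_star_set:
  assumes "0 \<le> s"
  shows "segment s u \<in> sym_star_sets"
proof -
  have "star_set (segment s u)"
  proof (rule star_setI)
    show "compact (segment s u)"
      unfolding segment_def by (intro compact_continuous_image continuous_intros) auto
    show "0 \<in> segment s u" using assms by (auto simp: segment_def image_iff intro!: bexI[of _ 0])
    fix x c assume "x \<in> segment s u" and c: "0 \<le> c" "c \<le> (1 :: real)"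
    then obtain d where "x = d *\<^sub>R u" "d \<in> {- s..s}" unfolding segment_def by blast
    then have d: "x = d *\<^sub>R u" "\<bar>d\<bar> \<le> s" by auto
    have "\<bar>c * d\<bar> \<le> 1 * s" unfolding abs_mult using c d by (intro mult_mono) auto
    then show "c *\<^sub>R x \<in> segment s u"
      unfolding segment_def d(1) by (intro image_eqI[of _ _ "c * d"]) (auto simp: abs_le_iff)
  qed
  moreover have "- y \<in> segment s u" if "y \<in> segment s u" for y
  proof -
    obtain d where d: "y = d *\<^sub>R u" "d \<in> {- s..s}" using \<open>y \<in> segment s u\<close> unfolding segment_def by blast
    then show ?thesis unfolding segment_def by (intro image_eqI[of _ _ "- d"]) auto
  qed
  then have "uminus ` segment s u = segment s u" by (auto simp: image_iff) (metis minus_minus)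
  ultimately show ?thesis by (simp add: sym_star_sets_def)
qed

lemma radial_function_segment:
  assumes "u \<noteq> 0" "0 \<le> s"
  shows "radial_function (segment s u) u = s"
  using assms by (intro radial_function_eqI) (auto simp: segment_def)

lemma radial_function_segment_off:
  assumes "u \<noteq> 0" "0 \<le> s" "x \<notin> span {u}"
  shows "radial_function (segment s u) x = 0"
proof -
  have "segment s u = segment s u \<inter> span {u}" by (auto simp: segment_def span_singleton)
  moreover have "0 \<in> segment s u"
    using segment_sym_star_set[OF assms(2), of u] by (simp add: sym_star_sets_def star_set_def)
  ultimately show ?thesis using radial_function_Int_subspace(2)[OF subspace_span _ assms(3)] by metis
qed

text \<open>The only unit vectors on the line are \<open>u\<close> and \<open>- u\<close>; off the
  line both radial functions vanish.\<close>

lemma radial_dist_segment_le: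
  assumes "norm u = 1" "0 \<le> s" "0 \<le> t"
  shows "radial_dist (segment s u) (segment t u) \<le> \<bar>s - t\<bar>"
proof (rule radial_dist_le)
  fix v :: "real ^ 'a" assume v: "norm v = 1"
  have u: "u \<noteq> 0" using assms by auto
  show "\<bar>radial_function (segment s u) v - radial_function (segment t u) v\<bar> \<le> \<bar>s - t\<bar>"
  proof (cases "v \<in> span {u}")
    case True
    then obtain k where k: "v = k *\<^sub>R u" by (auto simp: span_singleton)
    then have "\<bar>k\<bar> = 1" using v assms(1) by simp
    then have "v = u \<or> v = - u" using k by (auto simp: abs_if split: if_splits)
    then show ?thesis
      using radial_function_segment[OF u assms(2)] radial_function_segment[OF u assms(3)]
        radial_function_minus[OF segment_sym_star_set[OF assms(2)], of u u]
        radial_function_minus[OF segment_sym_star_set[OF assms(3)], of u u] by auto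
  next
    case False
    then show ?thesis
      using radial_function_segment_off[OF u assms(2)] radial_function_segment_off[OF u assms(3)] by simp
  qed
qed

lemma sym_star_set_Int_line:
  assumes "K \<in> sym_star_sets" "u \<noteq> 0"
  shows "K \<inter> span {u} = segment (radial_function K u) u"
proof -
  have K: "star_set K" using assms(1) by (rule sym_star_set_imp_star_set)
  have nn: "0 \<le> radial_function K u" using radial_function_nonneg[OF K assms(2)] .
  show ?thesis
  proof (rule star_set_eqI)
    show "star_set (K \<inter> span {u})" using star_set_Int_subspace[OF K subspace_span] .
    show "star_set (segment (radial_function K u) u)"
      using segment_sym_star_set[OF nn] by (rule sym_star_set_imp_star_set)
    fix x :: "real ^ 'a" assume x: "x \<noteq> 0"
    show "radial_function (K \<inter> span {u}) x = radial_function (segment (radial_function K u) u) x"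
    proof (cases "x \<in> span {u}")
      case False
      then show ?thesis
        using K radial_function_Int_subspace(2)[OF subspace_span _ False, of K]
          radial_function_segment_off[OF assms(2) nn False] by (simp add: star_set_def)
    next
      case True
      then obtain k where k: "x = k *\<^sub>R u" by (auto simp: span_singleton)
      have eq: "radial_function M (k *\<^sub>R u) = radial_function M u / \<bar>k\<bar>" if "M \<in> sym_star_sets" for M
      proof (cases "0 < k")
        case True
        then show ?thesis
          using radial_function_scaleR[OF sym_star_set_imp_star_set[OF that] assms(2)] by simp
      next
        case False
        then have "0 < - k" using x k by auto
        then show ?thesis
          using radial_function_scaleR[OF sym_star_set_imp_star_set[OF that] assms(2), of "- k"]
            radial_function_minus[OF that, of "k *\<^sub>R u"] by simp
      qed
      show ?thesis
        using radial_function_Int_subspace(1)[OF subspace_span True, of K] eq[OF assms(1)]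
          eq[OF segment_sym_star_set[OF nn]] radial_function_segment[OF assms(2) nn]
        unfolding k by simp
    qed
  qed
qed

lemma linear_image_segment:
  assumes "linear A"
  shows "A ` segment s u = segment s (A u)"
  by (simp add: segment_def image_image linear_scale[OF assms])

lemma scaleR_image_segment:
  assumes "0 \<le> r" "0 \<le> s"
  shows "(*\<^sub>R) r ` segment s u = segment (r * s) u"
proof (cases "r = 0")
  case True
  then show ?thesis using assms by (simp add: segment_def image_image image_constant_conv)
next
  case False
  then have "(*) r ` {- s..s} = {- (r * s)..r * s}"
    using assms by (simp add: image_mult_atLeastAtMost)
  moreover have "(*\<^sub>R) r ` segment s u = (\<lambda>c. c *\<^sub>R u) ` (*) r ` {- s..s}"
    unfolding segment_def image_image scaleR_scaleR ..
  ultimately show ?thesis by (simp only: segment_def)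
qed

section \<open>Operations acting pointwise on radial functions\<close>

definition induced_by :: "'n::finite set_operation \<Rightarrow> (real \<Rightarrow> real \<Rightarrow> real) \<Rightarrow> bool" where
  "induced_by f g \<longleftrightarrow> (\<forall>K\<in>sym_star_sets. \<forall>L\<in>sym_star_sets. \<forall>x. x \<noteq> 0 \<longrightarrow>
     radial_function (f K L) x = g (radial_function K x) (radial_function L x))"

lemma induced_byD:
  "induced_by f g \<Longrightarrow> K \<in> sym_star_sets \<Longrightarrow> L \<in> sym_star_sets \<Longrightarrow> x \<noteq> 0 \<Longrightarrow>
    radial_function (f K L) x = g (radial_function K x) (radial_function L x)"
  by (simp add: induced_by_def)

lemma induced_by_cong:
  assumes "\<And>s t. 0 \<le> s \<Longrightarrow> 0 \<le> t \<Longrightarrow> g s t = h s t" "induced_by f g"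
  shows "induced_by f h"
  using assms radial_function_nonneg sym_star_set_imp_star_set unfolding induced_by_def by metis

text \<open>Star sets are determined by their radial functions, so acting through \<open>g\<close>
  amounts to agreeing with a concrete operation \<open>T\<close> that does.\<close>

lemma induced_by_iff:
  assumes "\<And>K L. K \<in> sym_star_sets \<Longrightarrow> L \<in> sym_star_sets \<Longrightarrow> star_set (f K L)"
    and "\<And>K L. star_set K \<Longrightarrow> star_set L \<Longrightarrow> star_set (T K L)"
    and "\<And>K L x. star_set K \<Longrightarrow> star_set L \<Longrightarrow> x \<noteq> 0 \<Longrightarrow>
      radial_function (T K L) x = g (radial_function K x) (radial_function L x)"
  shows "induced_by f g \<longleftrightarrow> (\<forall>K\<in>sym_star_sets. \<forall>L\<in>sym_star_sets. f K L = T K L)"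
proof
  assume f: "induced_by f g"
  show "\<forall>K\<in>sym_star_sets. \<forall>L\<in>sym_star_sets. f K L = T K L"
  proof (intro ballI star_set_eqI)
    fix K L :: "(real ^ 'a) set" assume KL: "K \<in> sym_star_sets" "L \<in> sym_star_sets"
    then have st: "star_set K" "star_set L" by (auto intro: sym_star_set_imp_star_set)
    show "star_set (f K L)" using assms(1) KL .
    show "star_set (T K L)" using assms(2) st .
    fix x :: "real ^ 'a" assume "x \<noteq> 0"
    then show "radial_function (f K L) x = radial_function (T K L) x"
      using induced_byD[OF f KL] assms(3)[OF st] by simp
  qed
next
  assume "\<forall>K\<in>sym_star_sets. \<forall>L\<in>sym_star_sets. f K L = T K L"
  then show "induced_by f g" using assms(3) by (simp add: induced_by_def sym_star_set_imp_star_set)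
qed

text \<open>Values of \<open>f\<close> are only assumed to be star sets; symmetry is what allows
  \<open>f\<close> to be applied to them again.\<close>

lemma induced_by_sym:
  assumes "induced_by f g" "K \<in> sym_star_sets" "L \<in> sym_star_sets" "star_set (f K L)"
  shows "f K L \<in> sym_star_sets"
  using induced_byD[OF assms(1-3)] radial_function_minus[OF assms(2)] radial_function_minus[OF assms(3)] assms(4)
  by (intro sym_star_setsI) auto

lemma radial_function_scaleR_image:
  fixes M :: "(real ^ 'n) set"
  assumes "star_set M" "x \<noteq> 0" "0 \<le> r"
  shows "radial_function ((*\<^sub>R) r ` M) x = r * radial_function M x"
proof (cases "r = 0")
  case True
  have "(*\<^sub>R) 0 ` M = {0}" using assms by (auto simp: star_set_def)
  then show ?thesis using True radial_function_singleton_zero[OF assms(2)] by simp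
next
  case False
  then have r: "0 < r" using assms by simp
  have "inj ((*\<^sub>R) r :: real ^ 'n \<Rightarrow> _)" using r by (auto intro!: injI)
  then have "radial_function ((*\<^sub>R) r ` M) (r *\<^sub>R (x /\<^sub>R r)) = radial_function M (x /\<^sub>R r)"
    by (intro radial_function_image) auto
  then show ?thesis using radial_function_scaleR[OF assms(1,2), of "inverse r"] r by (simp add: field_simps)
qed

locale star_set_operation =
  fixes f :: "'n::finite set_operation"
  assumes star: "K \<in> sym_star_sets \<Longrightarrow> L \<in> sym_star_sets \<Longrightarrow> star_set (f K L)"
begin

lemma section_covariant_if_induced:
  assumes f: "induced_by f g" and g: "homogeneous_semigroup g"
  shows "section_covariant f"
  unfolding section_covariant_def
proof (intro ballI allI impI star_set_eqI)
  interpret homogeneous_semigroup g by (rule g)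
  fix K L :: "(real ^ 'n) set" and S :: "(real ^ 'n) set"
  assume KL: "K \<in> sym_star_sets" "L \<in> sym_star_sets" and "subspace S \<and> 1 \<le> dim S \<and> dim S \<le> CARD('n) - 1"
  then have S: "subspace S" by simp
  note KLS = sym_star_sets_Int_subspace[OF KL(1) S] sym_star_sets_Int_subspace[OF KL(2) S]
  show "star_set (f K L \<inter> S)" using star_set_Int_subspace[OF star[OF KL] S] .
  show "star_set (f (K \<inter> S) (L \<inter> S))" using star[OF KLS] .
  fix x :: "real ^ 'n" assume x: "x \<noteq> 0"
  have z: "0 \<in> K" "0 \<in> L" "0 \<in> f K L"
    using sym_star_set_imp_star_set[OF KL(1)] sym_star_set_imp_star_set[OF KL(2)] star[OF KL]
    by (simp_all add: star_set_def)
  \<comment> \<open>Outside \<open>S\<close> both sides vanish, the right one because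
    \<open>g 0 0 = 0\<close>.\<close>
  show "radial_function (f K L \<inter> S) x = radial_function (f (K \<inter> S) (L \<inter> S)) x"
    using radial_function_Int_subspace[OF S, where x = x] z induced_byD[OF f KL x] induced_byD[OF f KLS x]
    by (cases "x \<in> S") auto
qed

lemma rotation_covariant_if_induced:
  assumes f: "induced_by f g"
  shows "rotation_covariant f"
  unfolding rotation_covariant_def
proof (intro ballI allI impI star_set_eqI)
  fix K L :: "(real ^ 'n) set" and A :: "real ^ 'n ^ 'n"
  assume KL: "K \<in> sym_star_sets" "L \<in> sym_star_sets" and "rotation_matrix A"
  then have "invertible A" by (simp add: rotation_matrix_def invertible_det_nz)
  then have A: "inj ((*v) A)" "surj ((*v) A)"
    using invertible_left_inverse invertible_right_inverse matrix_left_invertible_injective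
      matrix_right_invertible_surjective by blast+
  have lin: "linear ((*v) A)" by simp
  note AKL = sym_star_sets_linear_image[OF KL(1) lin] sym_star_sets_linear_image[OF KL(2) lin]
  show "star_set ((*v) A ` f K L)" using star_set_linear_image[OF star[OF KL] lin] .
  show "star_set (f ((*v) A ` K) ((*v) A ` L))" using star[OF AKL] .
  fix x :: "real ^ 'n" assume x: "x \<noteq> 0"
  obtain y where y: "x = A *v y" using A(2) by blast
  then have "y \<noteq> 0" using x by auto
  have "radial_function ((*v) A ` M) x = radial_function M y" for M
    unfolding y by (intro radial_function_image A) (simp add: matrix_vector_mult_scaleR)
  then show "radial_function ((*v) A ` f K L) x = radial_function (f ((*v) A ` K) ((*v) A ` L)) x"
    using induced_byD[OF f KL \<open>y \<noteq> 0\<close>] induced_byD[OF f AKL x] by simp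
qed

lemma homogeneous_if_induced:
  assumes f: "induced_by f g" and g: "homogeneous_semigroup g"
  shows "homogeneous f"
  unfolding homogeneous_def
proof (intro ballI allI impI star_set_eqI)
  interpret homogeneous_semigroup g by (rule g)
  fix K L :: "(real ^ 'n) set" and r :: real
  assume KL: "K \<in> sym_star_sets" "L \<in> sym_star_sets" and r: "0 \<le> r"
  have lin: "linear ((*\<^sub>R) r :: real ^ 'n \<Rightarrow> _)" by (simp add: linear_scale_self)
  note rKL = sym_star_sets_linear_image[OF KL(1) lin] sym_star_sets_linear_image[OF KL(2) lin]
  have st: "star_set K" "star_set L" using KL by (auto intro: sym_star_set_imp_star_set)
  show "star_set ((*\<^sub>R) r ` f K L)" using star_set_linear_image[OF star[OF KL] lin] .
  show "star_set (f ((*\<^sub>R) r ` K) ((*\<^sub>R) r ` L))" using star[OF rKL] .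
  fix x :: "real ^ 'n" assume x: "x \<noteq> 0"
  show "radial_function (f ((*\<^sub>R) r ` K) ((*\<^sub>R) r ` L)) x = radial_function ((*\<^sub>R) r ` f K L) x"
    using induced_byD[OF f KL x] induced_byD[OF f rKL x] radial_function_nonneg[OF st(1) x]
      radial_function_nonneg[OF st(2) x] r
    by (simp add: radial_function_scaleR_image[OF _ x r] st star[OF KL] homog)
qed

lemma associative_if_induced:
  assumes f: "induced_by f g" and g: "homogeneous_semigroup g"
  shows "associative f"
  unfolding associative_def
proof (intro ballI star_set_eqI)
  interpret homogeneous_semigroup g by (rule g)
  fix K L N :: "(real ^ 'n) set"
  assume K: "K \<in> sym_star_sets" and L: "L \<in> sym_star_sets" and N: "N \<in> sym_star_sets"
  have KL: "f K L \<in> sym_star_sets" and LN: "f L N \<in> sym_star_sets"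
    using induced_by_sym[OF f] star K L N by blast+
  show "star_set (f K (f L N))" "star_set (f (f K L) N)" using star K L N KL LN by blast+
  fix x :: "real ^ 'n" assume x: "x \<noteq> 0"
  show "radial_function (f K (f L N)) x = radial_function (f (f K L) N) x"
    using induced_byD[OF f K LN x] induced_byD[OF f KL N x] induced_byD[OF f K L x] induced_byD[OF f L N x]
      radial_function_nonneg[OF sym_star_set_imp_star_set x] K L N by (simp add: assoc)
qed

text \<open>All radial values involved eventually lie in one compact rectangle, on which
  \<open>g\<close> is uniformly continuous; the resulting bound is uniform over the sphere.\<close>

lemma radially_continuous_if_induced:
  assumes f: "induced_by f g" and g: "homogeneous_semigroup g"
  shows "radially_continuous f"
  unfolding radially_continuous_def
proof (intro allI impI, elim conjE)
  interpret homogeneous_semigroup g by (rule g)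
  fix X Y :: "nat \<Rightarrow> (real ^ 'n) set" and K L
  assume X: "\<forall>m. X m \<in> sym_star_sets" and Y: "\<forall>m. Y m \<in> sym_star_sets"
    and K: "K \<in> sym_star_sets" and L: "L \<in> sym_star_sets"
    and XK: "radial_converges X K" and YL: "radial_converges Y L"
  have stX: "star_set (X m)" and stY: "star_set (Y m)" for m
    using X Y by (auto intro: sym_star_set_imp_star_set)
  have stK: "star_set K" and stL: "star_set L" using K L by (auto intro: sym_star_set_imp_star_set)
  obtain B where B: "\<And>u. norm u = 1 \<Longrightarrow> radial_function K u \<le> B" using radial_function_bound[OF stK] by metis
  obtain C where C: "\<And>u. norm u = 1 \<Longrightarrow> radial_function L u \<le> C" using radial_function_bound[OF stL] by metis
  let ?Q = "{0..B + 1} \<times> {0..C + 1}"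
  have "uniformly_continuous_on ?Q (\<lambda>z. g (fst z) (snd z))"
    by (intro compact_uniformly_continuous continuous_on_subset[OF cont] compact_Times) auto
  show "radial_converges (\<lambda>m. f (X m) (Y m)) (f K L)"
    unfolding radial_converges_def
  proof (rule LIMSEQ_I)
    fix e :: real assume e: "0 < e"
    then obtain d where d: "0 < d" and unif: "\<And>z w. z \<in> ?Q \<Longrightarrow> w \<in> ?Q \<Longrightarrow> dist w z < d \<Longrightarrow>
        dist (g (fst w) (snd w)) (g (fst z) (snd z)) < e / 2"
      using \<open>uniformly_continuous_on ?Q _\<close> unfolding uniformly_continuous_on_def by (metis half_gt_zero)
    \<comment> \<open>The bound 1 keeps nearby values inside the rectangle, whose sides were
      enlarged by 1; the bound \<open>d / 2\<close> lets two coordinate errors add up to less than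
      \<open>d\<close>.\<close>
    define d' where "d' = min 1 (d / 2)"
    have d': "0 < d'" "d' \<le> 1" "2 * d' \<le> d" using d by (auto simp: d'_def)
    obtain M where M: "\<And>m. M \<le> m \<Longrightarrow> \<bar>radial_dist (X m) K\<bar> < d'"
      using LIMSEQ_D[OF XK[unfolded radial_converges_def] d'(1)] by auto
    obtain N where N: "\<And>m. N \<le> m \<Longrightarrow> \<bar>radial_dist (Y m) L\<bar> < d'"
      using LIMSEQ_D[OF YL[unfolded radial_converges_def] d'(1)] by auto
    \<comment> \<open>A supremum of strictly bounded values is only weakly bounded, hence
      \<open>e / 2\<close> rather than \<open>e\<close>.\<close>
    have "radial_dist (f (X m) (Y m)) (f K L) \<le> e / 2" if m: "max M N \<le> m" for m
    proof (rule radial_dist_le)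
      fix u :: "real ^ 'n" assume u: "norm u = 1"
      then have u0: "u \<noteq> 0" by auto
      define a b s t where "a = radial_function (X m) u" and "b = radial_function (Y m) u"
        and "s = radial_function K u" and "t = radial_function L u"
      have nn: "0 \<le> a" "0 \<le> b" "0 \<le> s" "0 \<le> t"
        using radial_function_nonneg[OF _ u0] stX stY stK stL by (auto simp: a_def b_def s_def t_def)
      have as: "\<bar>a - s\<bar> < d'"
        using abs_diff_le_radial_dist[OF stX[of m] stK u] M[of m] m by (simp add: a_def s_def)
      have bt: "\<bar>b - t\<bar> < d'"
        using abs_diff_le_radial_dist[OF stY[of m] stL u] N[of m] m by (simp add: b_def t_def)
      have st: "s \<le> B" "t \<le> C" using B[OF u] C[OF u] by (auto simp: s_def t_def)
      have Q: "(s, t) \<in> ?Q" "(a, b) \<in> ?Q" using nn st as bt d' by auto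
      have "dist (a, b) (s, t) \<le> dist a s + dist b t"
        using sqrt_sum_squares_le_sum[of "dist a s" "dist b t"] by (simp add: dist_Pair_Pair)
      also have "\<dots> < d" using as bt d' by (simp add: dist_real_def)
      finally have "dist (g a b) (g s t) < e / 2" using unif[OF Q] by simp
      then show "\<bar>radial_function (f (X m) (Y m)) u - radial_function (f K L) u\<bar> \<le> e / 2"
        using induced_byD[OF f _ _ u0] X Y K L by (simp add: a_def b_def s_def t_def dist_real_def)
    qed
    moreover have "0 \<le> radial_dist (f (X m) (Y m)) (f K L)" for m
      using radial_dist_nonneg star X Y K L by blast
    ultimately show "\<exists>no. \<forall>n\<ge>no. norm (radial_dist (f (X n) (Y n)) (f K L) - 0) < e"
      using e by (intro exI[of _ "max M N"]) fastforce
  qed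
qed

end

section \<open>Examples of homogeneous semigroups\<close>

lemma homogeneous_semigroup_zero: "homogeneous_semigroup (\<lambda>s t. 0)"
  by unfold_locales auto

lemma homogeneous_semigroup_fst: "homogeneous_semigroup (\<lambda>s t. s)"
  by unfold_locales (auto intro!: continuous_intros)

lemma homogeneous_semigroup_snd: "homogeneous_semigroup (\<lambda>s t. t)"
  by unfold_locales (auto intro!: continuous_intros)

lemma homogeneous_semigroup_max: "homogeneous_semigroup max"
  by unfold_locales (auto intro!: continuous_intros simp: max_mult_distrib_left max.assoc)

lemma homogeneous_semigroup_min: "homogeneous_semigroup min"
  by unfold_locales (auto intro!: continuous_intros simp: min_mult_distrib_left min.assoc)

text \<open>Adding \<open>t powr p\<close> enlarges the base, and the outer exponent
  \<open>1 / p\<close> is negative. The bound yields continuity at the origin.\<close>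

lemma power_sum_le_left:
  assumes "p < 0" "0 \<le> s" "0 \<le> t"
  shows "power_sum p s t \<le> s"
proof (cases "0 < s \<and> 0 < t")
  case True
  then have "(s powr p + t powr p) powr (1 / p) \<le> (s powr p) powr (1 / p)"
    using assms by (intro powr_mono2') auto
  then show ?thesis using True assms by (simp add: power_sum_def powr_powr)
next
  case False
  then show ?thesis using assms by (auto simp: power_sum_def)
qed

lemma power_sum_nonneg: "0 \<le> power_sum p s t"
  by (simp add: power_sum_def)

text \<open>Clearing the negative powers gives a formula that is continuous off the origin and
  vanishes on the axes by itself.\<close>

lemma power_sum_neg_eq:
  assumes "p < 0" "0 \<le> s" "0 \<le> t"
  shows "power_sum p s t = s * t / (s powr (- p) + t powr (- p)) powr (1 / (- p))"
proof (cases "0 < s \<and> 0 < t")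
  case True
  define q where "q = - p"
  have q: "0 < q" "p = - q" using assms by (auto simp: q_def)
  have "s powr p + t powr p = (s powr q + t powr q) / (s * t) powr q"
    using True by (simp add: q powr_minus powr_mult field_simps)
  then have "power_sum p s t = ((s powr q + t powr q) / (s * t) powr q) powr (- (1 / q))"
    using True by (simp add: power_sum_def q)
  also have "\<dots> = inverse ((s powr q + t powr q) powr (1 / q) / ((s * t) powr q) powr (1 / q))"
    using True by (simp add: powr_minus powr_divide)
  also have "\<dots> = s * t / (s powr q + t powr q) powr (1 / q)"
    using True q by (simp add: powr_powr)
  finally show ?thesis by (simp add: q_def)
next
  case False
  then show ?thesis using assms by (auto simp: power_sum_def)
qed

text \<open>For \<open>p < 0\<close> the rewritten formula handles all points but the origin, where
  the value is squeezed between 0 and the first coordinate.\<close>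

lemma continuous_on_power_sum:
  assumes "p \<noteq> 0"
  shows "continuous_on ({0..} \<times> {0..}) (\<lambda>z. power_sum p (fst z) (snd z))"
proof (cases "0 < p")
  case True
  have "continuous_on ({0..} \<times> {0..}) (\<lambda>z. (fst z powr p + snd z powr p) powr (1 / p))"
    by (intro continuous_intros continuous_on_powr') (use True in auto)
  then show ?thesis using True by (simp add: power_sum_def)
next
  case False
  define q where "q = - p"
  have q: "0 < q" "p < 0" using False assms by (auto simp: q_def)
  let ?Q = "{0..} \<times> {0..} :: (real \<times> real) set"
  let ?h = "\<lambda>z. fst z * snd z / (fst z powr q + snd z powr q) powr (1 / q)"
  have pos: "0 < fst z powr q + snd z powr q" if "z \<in> ?Q - {0}" for z
  proof -
    have "fst z \<noteq> 0 \<or> snd z \<noteq> 0" using that by (auto simp: prod_eq_iff)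
    then show ?thesis by (auto intro: add_pos_nonneg add_nonneg_pos)
  qed
  have "continuous_on (?Q - {0}) ?h"
    by (intro continuous_intros continuous_on_powr') (use q pos in \<open>force+\<close>)
  then have off: "continuous_on (?Q - {0}) (\<lambda>z. power_sum p (fst z) (snd z))"
    using q by (subst continuous_on_cong[OF refl power_sum_neg_eq]) (auto simp: q_def)
  show ?thesis
    unfolding continuous_on_eq_continuous_within
  proof
    fix z assume z: "z \<in> ?Q"
    show "continuous (at z within ?Q) (\<lambda>z. power_sum p (fst z) (snd z))"
    proof (cases "z = 0")
      case False
      have "at z within ?Q = at z within (?Q - {0})"
        using False by (intro at_within_nhd[of z "- {0}"]) auto
      then show ?thesis
        using off z False unfolding continuous_on_eq_continuous_within by auto
    next
      case True
      have "((\<lambda>z. power_sum p (fst z) (snd z)) \<longlongrightarrow> 0) (at 0 within ?Q)"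
      proof (rule tendsto_sandwich[where f = "\<lambda>_. 0" and h = fst])
        show "\<forall>\<^sub>F z in at 0 within ?Q. 0 \<le> power_sum p (fst z) (snd z)"
          by (intro always_eventually allI power_sum_nonneg)
        have "power_sum p (fst z) (snd z) \<le> fst z" if "z \<in> ?Q" for z
          using power_sum_le_left[OF q(2)] that by auto
        then show "\<forall>\<^sub>F z in at 0 within ?Q. power_sum p (fst z) (snd z) \<le> fst z"
          unfolding eventually_at_filter by (intro always_eventually) blast
        show "(fst \<longlongrightarrow> 0) (at (0 :: real \<times> real) within ?Q)"
          using tendsto_fst[OF tendsto_ident_at, of "0 :: real \<times> real" ?Q] by simp
      qed simp
      then show ?thesis using True q by (simp add: continuous_within power_sum_def)
    qed
  qed
qed

text \<open>Both bracketings equal \<open>(r powr p + s powr p + t powr p) powr (1 / p)\<close>,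
  except when \<open>p < 0\<close> and some argument is 0; then both are 0.\<close>

lemma homogeneous_semigroup_power_sum:
  assumes "p \<noteq> 0"
  shows "homogeneous_semigroup (power_sum p)"
proof
  fix s t :: real assume st: "0 \<le> s" "0 \<le> t"
  show "0 \<le> power_sum p s t" by (rule power_sum_nonneg)
  fix r :: real assume r: "0 \<le> r"
  have powr: "power_sum p s t powr p = s powr p + t powr p" if "0 < p \<or> 0 < s \<and> 0 < t" for s t
    using that assms by (simp add: power_sum_def powr_powr)
  show "power_sum p (r * s) (r * t) = r * power_sum p s t"
  proof (cases "r = 0")
    case True
    then show ?thesis by (simp add: power_sum_def)
  next
    case False
    have "(r * s) powr p + (r * t) powr p = r powr p * (s powr p + t powr p)"
      using r st by (simp add: powr_mult distrib_left)
    then show ?thesis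
      using False r assms by (simp add: power_sum_def powr_mult powr_powr zero_less_mult_iff)
  qed
  show "power_sum p r (power_sum p s t) = power_sum p (power_sum p r s) t"
  proof (cases "0 < p \<or> 0 < r \<and> 0 < s \<and> 0 < t")
    case True
    have pos: "0 < power_sum p x y" if "0 < x" "0 < y" for x y
    proof -
      have "0 < x powr p + y powr p" using that by (simp add: add_pos_pos)
      then show ?thesis using that by (simp add: power_sum_def)
    qed
    have "power_sum p r (power_sum p s t) = (r powr p + (s powr p + t powr p)) powr (1 / p)"
      using True pos powr[of s t] by (subst power_sum_def) auto
    also have "\<dots> = power_sum p (power_sum p r s) t"
      using True pos powr[of r s] by (subst (2) power_sum_def) (auto simp: add.assoc)
    finally show ?thesis .
  next
    case False
    then show ?thesis using r st by (auto simp: power_sum_def)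
  qed
qed (rule continuous_on_power_sum[OF assms])

section \<open>Reduction to a homogeneous semigroup\<close>

context star_set_operation
begin

text \<open>Restricting to the line spanned by \<open>u\<close> replaces \<open>K\<close> and \<open>L\<close> by segments, and rotating \<open>u\<close> to a
  fixed unit vector makes the resulting function of the two half-lengths independent of \<open>u\<close>.\<close>

lemma induced_by_line_function:
  assumes "2 \<le> CARD('n)" and sec: "section_covariant f" and rot: "rotation_covariant f"
    and hom: "homogeneous f"
  defines "e \<equiv> axis undefined 1 :: real ^ 'n"
  defines "g \<equiv> \<lambda>s t. radial_function (f (segment s e) (segment t e)) e"
  shows "induced_by f g" and "\<And>r s t. 0 \<le> r \<Longrightarrow> 0 \<le> s \<Longrightarrow> 0 \<le> t \<Longrightarrow> g (r * s) (r * t) = r * g s t"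
proof -
  have e: "norm e = 1" "e \<noteq> 0" by (simp_all add: e_def norm_axis_1 axis_eq_0_iff)
  show ghom: "g (r * s) (r * t) = r * g s t" if "0 \<le> r" "0 \<le> s" "0 \<le> t" for r s t
    using hom[unfolded homogeneous_def, rule_format, OF segment_sym_star_set segment_sym_star_set, of s t r e e]
      radial_function_scaleR_image[OF star[OF segment_sym_star_set segment_sym_star_set] e(2), of s t r e e] that
    by (simp add: g_def scaleR_image_segment)
  have unit: "radial_function (f K L) u = g (radial_function K u) (radial_function L u)"
    if KL: "K \<in> sym_star_sets" "L \<in> sym_star_sets" and u: "norm u = 1" for K L u
  proof -
    have u0: "u \<noteq> 0" using u by auto
    define s t where "s = radial_function K u" and "t = radial_function L u"
    have st: "0 \<le> s" "0 \<le> t"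
      using radial_function_nonneg[OF sym_star_set_imp_star_set u0] KL by (auto simp: s_def t_def)
    \<comment> \<open>A line is an admissible section since the ambient dimension is at least
      2.\<close>
    have "dim (span {u}) = 1" using u0 by (simp add: dim_span dim_singleton)
    then have "f K L \<inter> span {u} = f (segment s u) (segment t u)"
      using sec[unfolded section_covariant_def, rule_format, OF KL, of "span {u}"] assms(1)
        sym_star_set_Int_line[OF KL(1) u0] sym_star_set_Int_line[OF KL(2) u0] by (simp add: s_def t_def)
    then have 1: "radial_function (f K L) u = radial_function (f (segment s u) (segment t u)) u"
      using radial_function_Int_subspace(1)[of "span {u}" u "f K L"] by (simp add: span_base)
    \<comment> \<open>From dimension 2 on, rotations act transitively on unit vectors; in dimension
      1 none would carry \<open>e\<close> to \<open>- e\<close>.\<close>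
    obtain A where A: "rotation_matrix A" "A *v e = u"
      using rotation_matrix_exists_basis[OF assms(1) u] unfolding e_def by blast
    then have "invertible A" by (simp add: rotation_matrix_def invertible_det_nz)
    then have inj: "inj ((*v) A)"
      using invertible_left_inverse matrix_left_invertible_injective by blast
    have lin: "linear ((*v) A)" by simp
    have "(*v) A ` f (segment s e) (segment t e) = f (segment s u) (segment t u)"
      using rot[unfolded rotation_covariant_def, rule_format,
          OF segment_sym_star_set[OF st(1)] segment_sym_star_set[OF st(2)] A(1)]
      by (simp add: linear_image_segment[OF lin] A(2))
    then have "radial_function (f (segment s u) (segment t u)) (A *v e) = g s t"
      unfolding g_def using radial_function_image[OF inj] by (metis matrix_vector_mult_scaleR)
    then show ?thesis using 1 by (simp add: A(2) s_def t_def)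
  qed
  show "induced_by f g"
    unfolding induced_by_def
  proof (intro ballI allI impI)
    fix K L :: "(real ^ 'n) set" and x :: "real ^ 'n"
    assume KL: "K \<in> sym_star_sets" "L \<in> sym_star_sets" and x: "x \<noteq> 0"
    define u where "u = x /\<^sub>R norm x"
    have u: "norm u = 1" "u \<noteq> 0" "x = norm x *\<^sub>R u" using x by (auto simp: u_def)
    \<comment> \<open>Radial functions have degree -1, so the same factor \<open>1 / norm x\<close>
      occurs on both sides and homogeneity of \<open>g\<close> absorbs it.\<close>
    have sc: "radial_function M x = (1 / norm x) * radial_function M u" if "star_set M" for M
      using radial_function_scaleR[OF that u(2), of "norm x"] u(3) x by simp
    have st: "star_set K" "star_set L" using KL by (auto intro: sym_star_set_imp_star_set)
    show "radial_function (f K L) x = g (radial_function K x) (radial_function L x)"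
      unfolding sc[OF st(1)] sc[OF st(2)] sc[OF star[OF KL]] unit[OF KL u(1)]
      using radial_function_nonneg[OF st(1) u(2)] radial_function_nonneg[OF st(2) u(2)]
      by (intro ghom[symmetric]) auto
  qed
qed

text \<open>Evaluating \<open>f\<close> on segments along the fixed direction \<open>e\<close>
  recovers \<open>g\<close>, so the properties of \<open>f\<close> descend to
  \<open>g\<close>.\<close>

lemma ex_homogeneous_semigroup:
  assumes "2 \<le> CARD('n)" and sec: "section_covariant f" and rot: "rotation_covariant f"
    and hom: "homogeneous f" and con: "radially_continuous f" and ass: "associative f"
  shows "\<exists>g. homogeneous_semigroup g \<and> induced_by f g"
proof -
  define e where "e = (axis undefined 1 :: real ^ 'n)"
  define g where "g = (\<lambda>s t. radial_function (f (segment s e) (segment t e)) e)"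
  have e: "norm e = 1" "e \<noteq> 0" by (simp_all add: e_def norm_axis_1 axis_eq_0_iff)
  have ind: "induced_by f g" and ghom: "\<And>r s t. 0 \<le> r \<Longrightarrow> 0 \<le> s \<Longrightarrow> 0 \<le> t \<Longrightarrow> g (r * s) (r * t) = r * g s t"
    using induced_by_line_function[OF assms(1-4)] unfolding g_def e_def by auto
  have seg: "segment s e \<in> sym_star_sets" if "0 \<le> s" for s using segment_sym_star_set[OF that] .
  have segr: "radial_function (segment s e) e = s" if "0 \<le> s" for s
    using radial_function_segment[OF e(2) that] .
  have "homogeneous_semigroup g"
  proof
    fix s t :: real assume st: "0 \<le> s" "0 \<le> t"
    show "0 \<le> g s t" unfolding g_def by (intro radial_function_nonneg star seg st e)
    fix r :: real assume r: "0 \<le> r"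
    show "g (r * s) (r * t) = r * g s t" by (rule ghom[OF r st])
    note R = seg[OF r] and S = seg[OF st(1)] and T = seg[OF st(2)]
    have RS: "f (segment r e) (segment s e) \<in> sym_star_sets"
      and ST: "f (segment s e) (segment t e) \<in> sym_star_sets"
      using induced_by_sym[OF ind] star R S T by blast+
    have "g r (g s t) = radial_function (f (segment r e) (f (segment s e) (segment t e))) e"
      using induced_byD[OF ind R ST e(2)] induced_byD[OF ind S T e(2)] segr r st by simp
    also have "\<dots> = radial_function (f (f (segment r e) (segment s e)) (segment t e)) e"
      using ass R S T by (simp add: associative_def)
    also have "\<dots> = g (g r s) t"
      using induced_byD[OF ind RS T e(2)] induced_byD[OF ind R S e(2)] segr r st by simp
    finally show "g r (g s t) = g (g r s) t" .
  next
    show "continuous_on ({0..} \<times> {0..}) (\<lambda>z. g (fst z) (snd z))"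
      unfolding continuous_on_sequentially comp_def
    proof (intro allI ballI impI, elim conjE)
      fix x :: "nat \<Rightarrow> real \<times> real" and a
      assume a: "a \<in> {0..} \<times> {0..}" and x: "\<forall>n. x n \<in> {0..} \<times> {0..}" and lim: "x \<longlonglongrightarrow> a"
      have nn: "0 \<le> fst a" "0 \<le> snd a" "\<And>n. 0 \<le> fst (x n)" "\<And>n. 0 \<le> snd (x n)"
        using a x by (auto simp: mem_Times_iff)
      have conv: "radial_converges (\<lambda>n. segment (p n) e) (segment q e)"
        if p: "\<And>n. 0 \<le> p n" "0 \<le> q" "p \<longlonglongrightarrow> q" for p q
        unfolding radial_converges_def
      proof (rule real_tendsto_sandwich[where f = "\<lambda>_. 0"])
        show "(\<lambda>n. \<bar>p n - q\<bar>) \<longlonglongrightarrow> 0" using p(3) by (simp add: LIM_zero_iff tendsto_rabs_zero_iff)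
        show "\<forall>\<^sub>F n in sequentially. radial_dist (segment (p n) e) (segment q e) \<le> \<bar>p n - q\<bar>"
          using radial_dist_segment_le[OF e(1)] p by simp
        show "\<forall>\<^sub>F n in sequentially. 0 \<le> radial_dist (segment (p n) e) (segment q e)"
          by (intro always_eventually allI radial_dist_nonneg sym_star_set_imp_star_set seg p)
      qed simp
      have "radial_converges (\<lambda>n. f (segment (fst (x n)) e) (segment (snd (x n)) e))
          (f (segment (fst a) e) (segment (snd a) e))"
        using con[unfolded radially_continuous_def, rule_format,
            of "\<lambda>n. segment (fst (x n)) e" "\<lambda>n. segment (snd (x n)) e" "segment (fst a) e" "segment (snd a) e"]
          seg nn conv[OF nn(3,1) tendsto_fst[OF lim]] conv[OF nn(4,2) tendsto_snd[OF lim]] by simp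
      then have "(\<lambda>n. radial_dist (f (segment (fst (x n)) e) (segment (snd (x n)) e))
          (f (segment (fst a) e) (segment (snd a) e))) \<longlonglongrightarrow> 0" by (simp add: radial_converges_def)
      then have "(\<lambda>n. g (fst (x n)) (snd (x n)) - g (fst a) (snd a)) \<longlonglongrightarrow> 0"
        by (rule Lim_null_comparison[rotated])
          (use abs_diff_le_radial_dist[OF star star e(1)] seg nn in \<open>simp add: g_def\<close>)
      then show "(\<lambda>n. g (fst (x n)) (snd (x n))) \<longlonglongrightarrow> g (fst a) (snd a)" by (simp add: LIM_zero_iff)
    qed
  qed
  then show ?thesis using ind by blast
qed

end

section \<open>The classification for symmetric star sets\<close>

theorem theoremC:
  fixes f :: "(real ^ 'n) set \<Rightarrow> (real ^ 'n) set \<Rightarrow> (real ^ 'n) set"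
  assumes "CARD('n) \<ge> 2"
    and "\<And>K L. K \<in> sym_star_sets \<Longrightarrow> L \<in> sym_star_sets \<Longrightarrow> f K L \<in> star_sets"
  shows "section_covariant f \<and> radially_continuous f \<and> rotation_covariant f \<and>
           homogeneous f \<and> associative f \<longleftrightarrow>
         (\<forall>K\<in>sym_star_sets. \<forall>L\<in>sym_star_sets. f K L = {0}) \<or>
         (\<forall>K\<in>sym_star_sets. \<forall>L\<in>sym_star_sets. f K L = K) \<or>
         (\<forall>K\<in>sym_star_sets. \<forall>L\<in>sym_star_sets. f K L = L) \<or>
         (\<exists>p::ereal. p \<noteq> 0 \<and>
            (\<forall>K\<in>sym_star_sets. \<forall>L\<in>sym_star_sets. f K L = radial_sum p K L))"
proof -
  interpret star_set_operation f
    by unfold_locales (use assms(2) in \<open>auto simp: star_sets_def\<close>)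
  have "section_covariant f \<and> radially_continuous f \<and> rotation_covariant f \<and>
      homogeneous f \<and> associative f \<longleftrightarrow> (\<exists>g. homogeneous_semigroup g \<and> induced_by f g)"
    using ex_homogeneous_semigroup[OF assms(1)] section_covariant_if_induced
      radially_continuous_if_induced rotation_covariant_if_induced homogeneous_if_induced
      associative_if_induced by blast
  \<comment> \<open>\<open>max\<close> and \<open>min\<close> stay separate from the power sums
    here; as exponents \<infinity> and -\<infinity> they are merged with the real exponents at the
    end.\<close>
  also have "\<dots> \<longleftrightarrow> induced_by f (\<lambda>s t. 0) \<or> induced_by f (\<lambda>s t. s) \<or> induced_by f (\<lambda>s t. t) \<or>
      induced_by f max \<or> induced_by f min \<or> (\<exists>p. p \<noteq> 0 \<and> induced_by f (power_sum p))" (is "_ \<longleftrightarrow> ?R")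
  proof
    assume "\<exists>g. homogeneous_semigroup g \<and> induced_by f g"
    then obtain g where g: "homogeneous_semigroup g" "induced_by f g" by blast
    have ind: "induced_by f h" if "\<forall>s\<ge>0. \<forall>t\<ge>0. g s t = h s t" for h
      using induced_by_cong[OF _ g(2)] that by blast
    show ?R
      using homogeneous_semigroup.classification[OF g(1)] ind[of "\<lambda>s t. 0"] ind[of "\<lambda>s t. s"]
        ind[of "\<lambda>s t. t"] ind[of max] ind[of min] ind[of "power_sum p" for p] by blast
  next
    have intro: "\<exists>g. homogeneous_semigroup g \<and> induced_by f g"
      if "homogeneous_semigroup h" "induced_by f h" for h using that by blast
    assume ?R
    then show "\<exists>g. homogeneous_semigroup g \<and> induced_by f g"
      by (elim disjE exE conjE)
        (erule intro[rotated], intro homogeneous_semigroup_zero homogeneous_semigroup_fst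
          homogeneous_semigroup_snd homogeneous_semigroup_max homogeneous_semigroup_min
          homogeneous_semigroup_power_sum; assumption)+
  qed
  also have "induced_by f (\<lambda>s t. 0) \<longleftrightarrow> (\<forall>K\<in>sym_star_sets. \<forall>L\<in>sym_star_sets. f K L = {0})"
    by (intro induced_by_iff star star_set_singleton_zero radial_function_singleton_zero)
  also have "induced_by f (\<lambda>s t. s) \<longleftrightarrow> (\<forall>K\<in>sym_star_sets. \<forall>L\<in>sym_star_sets. f K L = K)"
    by (intro induced_by_iff star) simp_all
  also have "induced_by f (\<lambda>s t. t) \<longleftrightarrow> (\<forall>K\<in>sym_star_sets. \<forall>L\<in>sym_star_sets. f K L = L)"
    by (intro induced_by_iff star) simp_all
  also have "induced_by f max \<longleftrightarrow> (\<forall>K\<in>sym_star_sets. \<forall>L\<in>sym_star_sets. f K L = radial_sum \<infinity> K L)"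
    by (intro induced_by_iff star) (simp_all add: radial_sum_def radial_function_Un)
  also have "induced_by f min \<longleftrightarrow> (\<forall>K\<in>sym_star_sets. \<forall>L\<in>sym_star_sets. f K L = radial_sum (- \<infinity>) K L)"
    by (intro induced_by_iff star) (simp_all add: radial_sum_def radial_function_Int)
  also have "(\<exists>p. p \<noteq> 0 \<and> induced_by f (power_sum p)) \<longleftrightarrow>
      (\<exists>p. p \<noteq> 0 \<and> (\<forall>K\<in>sym_star_sets. \<forall>L\<in>sym_star_sets. f K L = radial_sum (ereal p) K L))"
  proof (intro ex_cong conj_cong refl)
    fix p :: real assume p: "p \<noteq> 0"
    show "induced_by f (power_sum p) \<longleftrightarrow>
        (\<forall>K\<in>sym_star_sets. \<forall>L\<in>sym_star_sets. f K L = radial_sum (ereal p) K L)"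
      by (intro induced_by_iff star radial_function_radial_sum p)
  qed
  also have "(\<forall>K\<in>sym_star_sets. \<forall>L\<in>sym_star_sets. f K L = {0}) \<or>
      (\<forall>K\<in>sym_star_sets. \<forall>L\<in>sym_star_sets. f K L = K) \<or>
      (\<forall>K\<in>sym_star_sets. \<forall>L\<in>sym_star_sets. f K L = L) \<or>
      (\<forall>K\<in>sym_star_sets. \<forall>L\<in>sym_star_sets. f K L = radial_sum \<infinity> K L) \<or>
      (\<forall>K\<in>sym_star_sets. \<forall>L\<in>sym_star_sets. f K L = radial_sum (- \<infinity>) K L) \<or>
      (\<exists>p. p \<noteq> 0 \<and> (\<forall>K\<in>sym_star_sets. \<forall>L\<in>sym_star_sets. f K L = radial_sum (ereal p) K L)) \<longleftrightarrow>
    (\<forall>K\<in>sym_star_sets. \<forall>L\<in>sym_star_sets. f K L = {0}) \<or>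
      (\<forall>K\<in>sym_star_sets. \<forall>L\<in>sym_star_sets. f K L = K) \<or>
      (\<forall>K\<in>sym_star_sets. \<forall>L\<in>sym_star_sets. f K L = L) \<or>
      (\<exists>p::ereal. p \<noteq> 0 \<and> (\<forall>K\<in>sym_star_sets. \<forall>L\<in>sym_star_sets. f K L = radial_sum p K L))"
  proof -
    have ex: "(\<exists>p::ereal. p \<noteq> 0 \<and> P p) \<longleftrightarrow> P \<infinity> \<or> P (- \<infinity>) \<or> (\<exists>p. p \<noteq> 0 \<and> P (ereal p))" for P
    proof
      assume "\<exists>p. p \<noteq> 0 \<and> P p"
      then obtain p where "p \<noteq> 0" "P p" by blast
      then show "P \<infinity> \<or> P (- \<infinity>) \<or> (\<exists>p. p \<noteq> 0 \<and> P (ereal p))" by (cases p) auto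
    next
      assume "P \<infinity> \<or> P (- \<infinity>) \<or> (\<exists>p. p \<noteq> 0 \<and> P (ereal p))"
      then show "\<exists>p. p \<noteq> 0 \<and> P p"
        by (metis PInfty_neq_ereal(1) MInfty_neq_ereal(1) ereal_eq_0(1) zero_ereal_def)
    qed
    show ?thesis unfolding ex ..
  qed
  finally show ?thesis .
qed

end
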